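(* Let $A$ be a finite dimensional Hopf algebra over a field $k$ and let $M$ be a finite dimensional left $A$-module. Let $I_M=\bigcap_{n\ge 0}\mathrm{Ann}_A(M^{\otimes n})$ (which is a Hopf ideal of $A$) and let $\pi:A\to A/I_M$ be the canonical projection. Then: 1) $A^{co\,\pi}=\mathrm{LKer}_M$ and ${}^{co\,\pi}A=\mathrm{RKer}_M$; 2) $\mathrm{HKer}(\pi)=A_M$.
   Context: Sweedler notation $\Delta(a)=a_1\otimes a_2$ is used with summation omitted; $\epsilon$ is the counit. Tensor powers $M^{\otimes n}$ carry the diagonal action, and $M^{\otimes 0}=k$ is the trivial module. For a left $A$-module $M$: $\mathrm{LKer}_M=\{a\in A : a_1\otimes a_2m=a\otimes m \ \forall m\in M\}$; $\mathrm{RKer}_M=\{a\in A : a_2\otimes a_1m=a\otimes m \ \forall m\in M\}$; the Hopf kernel $A_M$ is the largest sub-bialgebra of $A$ contained in $\mathcal{S}_M=\{a\in A : am=\epsilon(a)m\ \forall m\in M\}$. For a Hopf algebra map $\pi:A\to B$: $A^{co\,\pi}=\{a\in A : a_1\otimes\pi(a_2)=a\otimes\pi(1)\}$, ${}^{co\,\pi}A=\{a\in A : \pi(a_1)\otimes a_2=\pi(1)\otimes a\}$, and $\mathrm{HKer}(\pi)=\{a\in A : a_1\otimes\pi(a_2)\otimes a_3=a_1\otimes\pi(1)\otimes a_2\}$. *)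

theory Defs
  imports Complex_Main "HOL-Library.Poly_Mapping" "HOL-Library.Set_Algebras"
begin

section \<open>Formal linear combinations\<close>

text \<open>The free vector space on a type \<open>'x\<close> is \<open>'x \<Rightarrow>\<^sub>0 'k\<close>.\<close>

definition fscale :: "'k::field \<Rightarrow> ('x \<Rightarrow>\<^sub>0 'k) \<Rightarrow> ('x \<Rightarrow>\<^sub>0 'k)" where
  "fscale c t = Poly_Mapping.map ((*) c) t"

lemma lookup_fscale [simp]: "Poly_Mapping.lookup (fscale c t) x = c * Poly_Mapping.lookup t x"
  by (simp add: fscale_def Poly_Mapping.map.rep_eq when_def)

global_interpretation formal: vector_space "fscale :: 'k::field \<Rightarrow> ('x \<Rightarrow>\<^sub>0 'k) \<Rightarrow> ('x \<Rightarrow>\<^sub>0 'k)"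
  by unfold_locales (auto intro!: poly_mapping_eqI simp: lookup_add algebra_simps)

abbreviation pure :: "'x \<Rightarrow> ('x \<Rightarrow>\<^sub>0 'k::field)" where
  "pure x \<equiv> Poly_Mapping.single x 1"

text \<open>Linear extension of a map from generators to a space with scalar multiplication \<open>s\<close>.\<close>

definition lin_ext :: "('k::field \<Rightarrow> 'v::ab_group_add \<Rightarrow> 'v) \<Rightarrow> ('x \<Rightarrow> 'v) \<Rightarrow> ('x \<Rightarrow>\<^sub>0 'k) \<Rightarrow> 'v" where
  "lin_ext s f t = (\<Sum>x\<in>Poly_Mapping.keys t. s (Poly_Mapping.lookup t x) (f x))"

abbreviation fbind :: "('x \<Rightarrow>\<^sub>0 'k::field) \<Rightarrow> ('x \<Rightarrow> ('y \<Rightarrow>\<^sub>0 'k)) \<Rightarrow> ('y \<Rightarrow>\<^sub>0 'k)" where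
  "fbind t f \<equiv> lin_ext fscale f t"

abbreviation fmap :: "('x \<Rightarrow> 'y) \<Rightarrow> ('x \<Rightarrow>\<^sub>0 'k::field) \<Rightarrow> ('y \<Rightarrow>\<^sub>0 'k)" where
  "fmap f t \<equiv> fbind t (\<lambda>x. pure (f x))"


section \<open>Vector spaces with carrier, and quotients\<close>

text \<open>Carriers are explicit here because a quotient space, whose elements are cosets, does not
  occupy a whole type.\<close>

record ('k, 'v) vspace =
  car :: "'v set"
  vadd :: "'v \<Rightarrow> 'v \<Rightarrow> 'v"
  scl :: "'k \<Rightarrow> 'v \<Rightarrow> 'v"

definition full_space :: "('k::field \<Rightarrow> 'v::ab_group_add \<Rightarrow> 'v) \<Rightarrow> ('k, 'v) vspace" where
  "full_space s = \<lparr>car = UNIV, vadd = (+), scl = s\<rparr>"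

text \<open>Below, \<open>+\<close> on sets is the elementwise sum. Adding the subspace \<open>N\<close> in
  \<open>coset_scale\<close> is only needed for the scalar 0.\<close>

definition coset_scale ::
    "('k::field \<Rightarrow> 'v::ab_group_add \<Rightarrow> 'v) \<Rightarrow> 'v set \<Rightarrow> 'k \<Rightarrow> 'v set \<Rightarrow> 'v set" where
  "coset_scale s N c X = s c ` X + N"

definition quotient_space ::
    "('k::field \<Rightarrow> 'v::ab_group_add \<Rightarrow> 'v) \<Rightarrow> 'v set \<Rightarrow> ('k, 'v set) vspace" where
  "quotient_space s N = \<lparr>car = range (\<lambda>v. v +o N), vadd = (+), scl = coset_scale s N\<rparr>"


section \<open>Tensor products\<close>

text \<open>
  A tensor product is the free vector space on tuples modulo the multilinearity relations; its
  elements are cosets. Given a way \<open>c\<close> of placing a vector in one slot of a tuple whose other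
  entries are fixed, \<open>slot_rels\<close> expresses linearity in this slot.
\<close>

definition slot_rels :: "('k::field, 'v) vspace \<Rightarrow> ('v \<Rightarrow> 'x) \<Rightarrow> ('x \<Rightarrow>\<^sub>0 'k) set" where
  "slot_rels V c =
     {pure (c (vadd V v w)) - pure (c v) - pure (c w) | v w. v \<in> car V \<and> w \<in> car V} \<union>
     {pure (c (scl V r v)) - fscale r (pure (c v)) | r v. v \<in> car V}"

definition rels2 :: "('k::field, 'v) vspace \<Rightarrow> ('k, 'w) vspace \<Rightarrow> ('v \<times> 'w \<Rightarrow>\<^sub>0 'k) set" where
  "rels2 V W = (\<Union>w\<in>car W. slot_rels V (\<lambda>v. (v, w))) \<union> (\<Union>v\<in>car V. slot_rels W (\<lambda>w. (v, w)))"

definition rels3 ::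
    "('k::field, 'u) vspace \<Rightarrow> ('k, 'v) vspace \<Rightarrow> ('k, 'w) vspace \<Rightarrow> ('u \<times> 'v \<times> 'w \<Rightarrow>\<^sub>0 'k) set" where
  "rels3 U V W =
     (\<Union>v\<in>car V. \<Union>w\<in>car W. slot_rels U (\<lambda>u. (u, v, w))) \<union>
     (\<Union>u\<in>car U. \<Union>w\<in>car W. slot_rels V (\<lambda>v. (u, v, w))) \<union>
     (\<Union>u\<in>car U. \<Union>v\<in>car V. slot_rels W (\<lambda>w. (u, v, w)))"

definition rels_pow :: "('k::field, 'v) vspace \<Rightarrow> nat \<Rightarrow> ('v list \<Rightarrow>\<^sub>0 'k) set" where
  "rels_pow V n =
     (\<Union>(xs, ys)\<in>{(xs, ys). xs \<in> lists (car V) \<and> ys \<in> lists (car V) \<and> length xs + length ys + 1 = n}.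
        slot_rels V (\<lambda>v. xs @ v # ys))"

text \<open>The tensor represented by a formal combination of tuples.\<close>

definition tens2 ::
    "('k::field, 'v) vspace \<Rightarrow> ('k, 'w) vspace \<Rightarrow> ('v \<times> 'w \<Rightarrow>\<^sub>0 'k) \<Rightarrow> ('v \<times> 'w \<Rightarrow>\<^sub>0 'k) set" where
  "tens2 V W t = t +o formal.span (rels2 V W)"

definition tens3 ::
    "('k::field, 'u) vspace \<Rightarrow> ('k, 'v) vspace \<Rightarrow> ('k, 'w) vspace \<Rightarrow>
     ('u \<times> 'v \<times> 'w \<Rightarrow>\<^sub>0 'k) \<Rightarrow> ('u \<times> 'v \<times> 'w \<Rightarrow>\<^sub>0 'k) set" where
  "tens3 U V W t = t +o formal.span (rels3 U V W)"

definition tens_pow ::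
    "('k::field, 'v) vspace \<Rightarrow> nat \<Rightarrow> ('v list \<Rightarrow>\<^sub>0 'k) \<Rightarrow> ('v list \<Rightarrow>\<^sub>0 'k) set" where
  "tens_pow V n t = t +o formal.span (rels_pow V n)"

text \<open>The image of \<open>X \<otimes> Y\<close> in \<open>V \<otimes> W\<close> for subspaces \<open>X\<close> of \<open>V\<close> and \<open>Y\<close> of \<open>W\<close>.\<close>

definition tensor_image ::
    "('k::field, 'v) vspace \<Rightarrow> ('k, 'w) vspace \<Rightarrow> 'v set \<Rightarrow> 'w set \<Rightarrow> ('v \<times> 'w \<Rightarrow>\<^sub>0 'k) set set" where
  "tensor_image V W X Y = tens2 V W ` {t. Poly_Mapping.keys t \<subseteq> X \<times> Y}"

text \<open>The carrier of the \<open>n\<close>-th tensor power. For \<open>n = 0\<close> there are no relations and the empty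
  list is the only generator, so this is the ground field.\<close>

definition tensor_power :: "('k::field, 'v) vspace \<Rightarrow> nat \<Rightarrow> ('v list \<Rightarrow>\<^sub>0 'k) set set" where
  "tensor_power V n =
     tens_pow V n ` {t. Poly_Mapping.keys t \<subseteq> {xs. xs \<in> lists (car V) \<and> length xs = n}}"

definition rep :: "('x \<Rightarrow>\<^sub>0 'k::field) set \<Rightarrow> ('x \<Rightarrow>\<^sub>0 'k)" where
  "rep T = (SOME t. t \<in> T)"


section \<open>Hopf algebras\<close>

record (overloaded) ('k, 'a) hopf =
  hscale :: "'k \<Rightarrow> 'a \<Rightarrow> 'a"
  comul :: "'a \<Rightarrow> ('a \<times> 'a \<Rightarrow>\<^sub>0 'k) set"
  counit :: "'a \<Rightarrow> 'k"
  antipode :: "'a \<Rightarrow> 'a"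

abbreviation hspace :: "('k::field, 'a::ring_1) hopf \<Rightarrow> ('k, 'a) vspace" where
  "hspace A \<equiv> full_space (hscale A)"

text \<open>
  Sweedler notation: \<open>sw2 A a\<close> is a formal combination of pairs representing the tensor
  \<open>comul A a\<close>, and \<open>sw3 A a\<close> one of triples representing its iterate. They are only used in
  expressions linear in each tensor factor, whose values do not depend on the representatives.
\<close>

definition sw2 :: "('k::field, 'a::ring_1) hopf \<Rightarrow> 'a \<Rightarrow> ('a \<times> 'a \<Rightarrow>\<^sub>0 'k)" where
  "sw2 A a = rep (comul A a)"

definition sw3 :: "('k::field, 'a::ring_1) hopf \<Rightarrow> 'a \<Rightarrow> ('a \<times> 'a \<times> 'a \<Rightarrow>\<^sub>0 'k)" where
  "sw3 A a = fbind (sw2 A a) (\<lambda>(x, y). fmap (\<lambda>(u, v). (x, u, v)) (sw2 A y))"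

locale k_algebra = vector_space "hscale A"
  for A :: "('k::field, 'a::ring_1) hopf" +
  assumes scale_mult_left: "hscale A c x * y = hscale A c (x * y)"
    and scale_mult_right: "x * hscale A c y = hscale A c (x * y)"

locale k_coalgebra = vector_space "hscale A"
  for A :: "('k::field, 'a::ring_1) hopf" +
  assumes comul_closed: "comul A a \<in> tensor_image (hspace A) (hspace A) UNIV UNIV"
    and comul_add: "comul A (a + b) = comul A a + comul A b"
    and comul_scale: "comul A (hscale A c a) =
      coset_scale fscale (formal.span (rels2 (hspace A) (hspace A))) c (comul A a)"
    and counit_linear: "Vector_Spaces.linear (hscale A) (*) (counit A)"
    and coassoc:
      "tens3 (hspace A) (hspace A) (hspace A)
         (fbind (sw2 A a) (\<lambda>(x, y). fmap (\<lambda>(u, v). (u, v, y)) (sw2 A x))) =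
       tens3 (hspace A) (hspace A) (hspace A)
         (fbind (sw2 A a) (\<lambda>(x, y). fmap (\<lambda>(u, v). (x, u, v)) (sw2 A y)))"
    and counit_left: "lin_ext (hscale A) (\<lambda>(x, y). hscale A (counit A x) y) (sw2 A a) = a"
    and counit_right: "lin_ext (hscale A) (\<lambda>(x, y). hscale A (counit A y) x) (sw2 A a) = a"

locale k_bialgebra = k_algebra A + k_coalgebra A
  for A :: "('k::field, 'a::ring_1) hopf" +
  assumes comul_one: "comul A 1 = tens2 (hspace A) (hspace A) (pure (1, 1))"
    and comul_mult: "comul A (a * b) = tens2 (hspace A) (hspace A)
      (fbind (sw2 A a) (\<lambda>(x, y). fmap (\<lambda>(u, v). (x * u, y * v)) (sw2 A b)))"
    and counit_one: "counit A 1 = 1"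
    and counit_mult: "counit A (a * b) = counit A a * counit A b"

locale hopf_algebra = k_bialgebra A
  for A :: "('k::field, 'a::ring_1) hopf" +
  assumes antipode_linear: "Vector_Spaces.linear (hscale A) (hscale A) (antipode A)"
    and antipode_left:
      "lin_ext (hscale A) (\<lambda>(x, y). antipode A x * y) (sw2 A a) = hscale A (counit A a) 1"
    and antipode_right:
      "lin_ext (hscale A) (\<lambda>(x, y). x * antipode A y) (sw2 A a) = hscale A (counit A a) 1"

definition sub_bialgebra :: "('k::field, 'a::ring_1) hopf \<Rightarrow> 'a set \<Rightarrow> bool" where
  "sub_bialgebra A H \<longleftrightarrow>
     module.subspace (hscale A) H \<and> 1 \<in> H \<and> (\<forall>x\<in>H. \<forall>y\<in>H. x * y \<in> H) \<and>
     (\<forall>x\<in>H. comul A x \<in> tensor_image (hspace A) (hspace A) H H)"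

definition hopf_ideal :: "('k::field, 'a::ring_1) hopf \<Rightarrow> 'a set \<Rightarrow> bool" where
  "hopf_ideal A I \<longleftrightarrow>
     module.subspace (hscale A) I \<and> (\<forall>a. \<forall>x\<in>I. a * x \<in> I \<and> x * a \<in> I) \<and>
     (\<forall>x\<in>I. comul A x \<in>
        tensor_image (hspace A) (hspace A) I UNIV + tensor_image (hspace A) (hspace A) UNIV I) \<and>
     (\<forall>x\<in>I. counit A x = 0) \<and> (\<forall>x\<in>I. antipode A x \<in> I)"


section \<open>Coinvariants and the Hopf kernel of a map\<close>

text \<open>
  For a linear map \<open>\<pi>\<close> from \<open>A\<close> to a space \<open>B\<close>. Only the vector space structure of \<open>B\<close> and the
  element \<open>\<pi> 1\<close> enter.
\<close>

definition right_coinvariants ::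
    "('k::field, 'a::ring_1) hopf \<Rightarrow> ('k, 'b) vspace \<Rightarrow> ('a \<Rightarrow> 'b) \<Rightarrow> 'a set" where
  "right_coinvariants A B \<pi> =
     {a. tens2 (hspace A) B (fmap (\<lambda>(x, y). (x, \<pi> y)) (sw2 A a)) =
         tens2 (hspace A) B (pure (a, \<pi> 1))}"

definition left_coinvariants ::
    "('k::field, 'a::ring_1) hopf \<Rightarrow> ('k, 'b) vspace \<Rightarrow> ('a \<Rightarrow> 'b) \<Rightarrow> 'a set" where
  "left_coinvariants A B \<pi> =
     {a. tens2 B (hspace A) (fmap (\<lambda>(x, y). (\<pi> x, y)) (sw2 A a)) =
         tens2 B (hspace A) (pure (\<pi> 1, a))}"

definition HKer ::
    "('k::field, 'a::ring_1) hopf \<Rightarrow> ('k, 'b) vspace \<Rightarrow> ('a \<Rightarrow> 'b) \<Rightarrow> 'a set" where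
  "HKer A B \<pi> =
     {a. tens3 (hspace A) B (hspace A) (fmap (\<lambda>(x, y, z). (x, \<pi> y, z)) (sw3 A a)) =
         tens3 (hspace A) B (hspace A) (fmap (\<lambda>(x, y). (x, \<pi> 1, y)) (sw2 A a))}"


section \<open>Modules and their kernels\<close>

locale left_module = vector_space sM
  for A :: "('k::field, 'a::ring_1) hopf"
    and sM :: "'k \<Rightarrow> 'm::ab_group_add \<Rightarrow> 'm"
    and act :: "'a \<Rightarrow> 'm \<Rightarrow> 'm" +
  assumes act_add_left: "act (a + b) m = act a m + act b m"
    and act_scale_left: "act (hscale A c a) m = sM c (act a m)"
    and act_add_right: "act a (m + m') = act a m + act a m'"
    and act_scale_right: "act a (sM c m) = sM c (act a m)"
    and act_one: "act 1 m = m"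
    and act_mult: "act (a * b) m = act a (act b m)"

definition LKer ::
    "('k::field, 'a::ring_1) hopf \<Rightarrow> ('k \<Rightarrow> 'm::ab_group_add \<Rightarrow> 'm) \<Rightarrow> ('a \<Rightarrow> 'm \<Rightarrow> 'm) \<Rightarrow> 'a set" where
  "LKer A sM act =
     {a. \<forall>m. tens2 (hspace A) (full_space sM) (fmap (\<lambda>(x, y). (x, act y m)) (sw2 A a)) =
             tens2 (hspace A) (full_space sM) (pure (a, m))}"

definition RKer ::
    "('k::field, 'a::ring_1) hopf \<Rightarrow> ('k \<Rightarrow> 'm::ab_group_add \<Rightarrow> 'm) \<Rightarrow> ('a \<Rightarrow> 'm \<Rightarrow> 'm) \<Rightarrow> 'a set" where
  "RKer A sM act =
     {a. \<forall>m. tens2 (hspace A) (full_space sM) (fmap (\<lambda>(x, y). (y, act x m)) (sw2 A a)) =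
             tens2 (hspace A) (full_space sM) (pure (a, m))}"

definition trivial_part ::
    "('k::field, 'a::ring_1) hopf \<Rightarrow> ('k \<Rightarrow> 'm::ab_group_add \<Rightarrow> 'm) \<Rightarrow> ('a \<Rightarrow> 'm \<Rightarrow> 'm) \<Rightarrow> 'a set" where
  "trivial_part A sM act = {a. \<forall>m. act a m = sM (counit A a) m}"

definition is_hopf_kernel ::
    "('k::field, 'a::ring_1) hopf \<Rightarrow> ('k \<Rightarrow> 'm::ab_group_add \<Rightarrow> 'm) \<Rightarrow> ('a \<Rightarrow> 'm \<Rightarrow> 'm) \<Rightarrow>
     'a set \<Rightarrow> bool" where
  "is_hopf_kernel A sM act H \<longleftrightarrow>
     sub_bialgebra A H \<and> H \<subseteq> trivial_part A sM act \<and>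
     (\<forall>H'. sub_bialgebra A H' \<and> H' \<subseteq> trivial_part A sM act \<longrightarrow> H' \<subseteq> H)"

definition hopf_kernel ::
    "('k::field, 'a::ring_1) hopf \<Rightarrow> ('k \<Rightarrow> 'm::ab_group_add \<Rightarrow> 'm) \<Rightarrow> ('a \<Rightarrow> 'm \<Rightarrow> 'm) \<Rightarrow> 'a set" where
  "hopf_kernel A sM act = (THE H. is_hopf_kernel A sM act H)"


section \<open>The diagonal action on tensor powers\<close>

text \<open>\<open>diag_word\<close> is the action on a word \<open>m\<^sub>1 \<otimes> \<dots> \<otimes> m\<^sub>n\<close>: through the counit on the empty word,
  and as \<open>a\<^sub>1 m\<^sub>1 \<otimes> a\<^sub>2 (m\<^sub>2 \<otimes> \<dots> \<otimes> m\<^sub>n)\<close> otherwise.\<close>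

primrec diag_word ::
    "('k::field, 'a::ring_1) hopf \<Rightarrow> ('a \<Rightarrow> 'm \<Rightarrow> 'm) \<Rightarrow> 'm list \<Rightarrow> 'a \<Rightarrow> ('m list \<Rightarrow>\<^sub>0 'k)" where
  "diag_word A act [] = (\<lambda>a. Poly_Mapping.single [] (counit A a))"
| "diag_word A act (m # ms) =
     (\<lambda>a. fbind (sw2 A a) (\<lambda>(x, y). fmap (\<lambda>ws. act x m # ws) (diag_word A act ms y)))"

definition diag_act ::
    "('k::field, 'a::ring_1) hopf \<Rightarrow> ('k \<Rightarrow> 'm::ab_group_add \<Rightarrow> 'm) \<Rightarrow> ('a \<Rightarrow> 'm \<Rightarrow> 'm) \<Rightarrow> nat \<Rightarrow>
     'a \<Rightarrow> ('m list \<Rightarrow>\<^sub>0 'k) set \<Rightarrow> ('m list \<Rightarrow>\<^sub>0 'k) set" where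
  "diag_act A sM act n a T =
     tens_pow (full_space sM) n (fbind (rep T) (\<lambda>ms. diag_word A act ms a))"

definition power_annihilator ::
    "('k::field, 'a::ring_1) hopf \<Rightarrow> ('k \<Rightarrow> 'm::ab_group_add \<Rightarrow> 'm) \<Rightarrow> ('a \<Rightarrow> 'm \<Rightarrow> 'm) \<Rightarrow> nat \<Rightarrow>
     'a set" where
  "power_annihilator A sM act n =
     {a. \<forall>T\<in>tensor_power (full_space sM) n.
           diag_act A sM act n a T = tens_pow (full_space sM) n 0}"

end

theory Submission
  imports Defs "HOL-Library.Function_Algebras"
begin

text \<open>
  The proof takes place in the dual algebra \<open>A\<^sup>*\<close> with the convolution product
  \<open>(f * g)(a) = \<Sum> f(a\<^sub>1) g(a\<^sub>2)\<close>, whose unit is \<open>\<epsilon>\<close>. For \<open>m\<close> in \<open>M\<close> and a linear form \<open>\<phi>\<close> on \<open>M\<close>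
  consider the matrix coefficient \<open>c(a) = \<phi>(a m)\<close>, for which \<open>c(1) = \<phi>(m)\<close>. The coefficients of
  the diagonal action on \<open>M\<^sup>\<otimes>\<^sup>n\<close> are spanned by the \<open>n\<close>-fold products of such \<open>c\<close> (by \<open>\<epsilon>\<close> for
  \<open>n = 0\<close>). Hence the ideal \<open>I\<close> of the statement is the common kernel of the subalgebra \<open>D\<close> of
  \<open>A\<^sup>*\<close> generated by the matrix coefficients of \<open>M\<close> (\<open>ann_iff\<close>). This passage from tensors to forms is possible
  because a tensor over finite-dimensional spaces vanishes as soon as all products of linear forms
  vanish on it (\<open>tens2_eq_iff\<close>, \<open>tens3_eq_iff\<close>, \<open>in_span_rels_pow\<close>).

  \<open>I\<close> is a Hopf ideal. It is a two-sided ideal because \<open>D\<close> is stable under translating the argument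
  by elements of \<open>A\<close>, and a coideal because \<open>D\<close> is closed under products and contains \<open>\<epsilon>\<close>. Stability
  under the antipode \<open>S\<close> is then a matter of dimension (\<open>antipode_stable\<close>): \<open>h \<mapsto> id * h\<close> maps the
  space of endomorphisms that preserve \<open>I\<close> to itself and is injective because \<open>S * id\<close> is the
  convolution unit; so it is surjective, and the preimage of the convolution unit, which is \<open>S\<close>,
  preserves \<open>I\<close>.

  Part 1. In terms of forms, \<open>a\<close> lies in \<open>LKer\<close> iff \<open>(f * c)(a) = f(a) c(1)\<close> for all \<open>f\<close> and all
  matrix coefficients \<open>c\<close>, and \<open>a\<close> is a coinvariant iff \<open>(f * g)(a) = f(a) g(1)\<close> for all \<open>f\<close> and all
  \<open>g\<close> that vanish on \<open>I\<close>. As \<open>g \<mapsto> g(1)\<close> is multiplicative for convolution, the first condition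
  extends from the generators \<open>c\<close> to all of \<open>D\<close>. It then says that \<open>D\<close> annihilates the vector
  \<open>\<Sum> f(a\<^sub>1) a\<^sub>2 - f(a) 1\<close>, so this vector lies in \<open>I\<close>, and the second condition follows. \<open>RKer\<close> is
  the mirror image.

  Part 2. In the same way \<open>a\<close> lies in \<open>HKer\<close> iff \<open>(f * c * h)(a) = c(1) (f * h)(a)\<close> for all \<open>f\<close>,
  \<open>h\<close> and \<open>c\<close> (\<open>HKer_iff\<close>). This set is stable under \<open>a \<mapsto> \<Sum> f(a\<^sub>1) a\<^sub>2\<close> and
  \<open>a \<mapsto> \<Sum> a\<^sub>1 f(a\<^sub>2)\<close>, so it is a subcoalgebra (\<open>sub_bialgebra_ker\<close>); a computation with
  Sweedler sums shows that it is closed under products (\<open>mult_in_ker\<close>). Taking \<open>f = h = \<epsilon>\<close> shows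
  that it acts trivially on \<open>M\<close>. Conversely, if a subcoalgebra \<open>H\<close> acts trivially, then \<open>c\<close> agrees
  with \<open>c(1) \<epsilon>\<close> on \<open>H\<close>, and the displayed identity holds on \<open>H\<close> (\<open>sub_bialgebra_le_ker\<close>).
\<close>

section \<open>Linear extension\<close>

lemma vector_space_field: "vector_space ((*) :: 'k::field \<Rightarrow> 'k \<Rightarrow> 'k)"
  by unfold_locales (simp_all add: algebra_simps)

abbreviation pairing :: "('x \<Rightarrow> 'k::field) \<Rightarrow> ('x \<Rightarrow>\<^sub>0 'k) \<Rightarrow> 'k" where
  "pairing \<equiv> lin_ext (*)"

abbreviation linear_form :: "('k::field \<Rightarrow> 'v::ab_group_add \<Rightarrow> 'v) \<Rightarrow> ('v \<Rightarrow> 'k) \<Rightarrow> bool" where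
  "linear_form s f \<equiv> Vector_Spaces.linear s (*) f"

lemma linear_formI:
  assumes "vector_space s" "\<And>v w. f (v + w) = f v + f w" "\<And>r v. f (s r v) = r * f v"
  shows "linear_form s f"
  using assms by (simp add: Vector_Spaces.linear_iff vector_space_field)

lemma linear_add: "Vector_Spaces.linear s s' f \<Longrightarrow> f (v + w) = f v + f w"
  and linear_scale: "Vector_Spaces.linear s s' f \<Longrightarrow> f (s r v) = s' r (f v)"
  by (simp_all add: Vector_Spaces.linear_iff)

lemma linear_zero: "Vector_Spaces.linear s s' f \<Longrightarrow> f 0 = 0"
  by (metis add_cancel_right_right linear_add)

lemma linear_diff: "Vector_Spaces.linear s s' f \<Longrightarrow> f (v - w) = f v - f w"
  by (metis add_diff_cancel_right' diff_add_cancel linear_add)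

lemma linear_sum: "Vector_Spaces.linear s s' f \<Longrightarrow> f (sum g K) = (\<Sum>x\<in>K. f (g x))"
  by (induction K rule: infinite_finite_induct) (simp_all add: linear_zero linear_add)

lemma lin_ext_compose:
  "Vector_Spaces.linear s s' g \<Longrightarrow> g (lin_ext s f t) = lin_ext s' (\<lambda>x. g (f x)) t"
  by (simp add: lin_ext_def linear_sum linear_scale)

lemma lin_ext_cong:
  "(\<And>x. x \<in> Poly_Mapping.keys t \<Longrightarrow> f x = g x) \<Longrightarrow> lin_ext s f t = lin_ext s g t"
  by (simp add: lin_ext_def)

context vector_space
begin

lemma lin_ext_superset:
  assumes "finite K" "Poly_Mapping.keys t \<subseteq> K"
  shows "lin_ext scale f t = (\<Sum>x\<in>K. scale (Poly_Mapping.lookup t x) (f x))"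
  unfolding lin_ext_def by (rule sum.mono_neutral_left) (use assms in \<open>auto simp: in_keys_iff\<close>)

lemma linear_lin_ext: "Vector_Spaces.linear fscale scale (lin_ext scale f)"
  unfolding Vector_Spaces.linear_iff
proof (intro conjI allI)
  show "vector_space fscale" "vector_space scale"
    by (fact formal.vector_space_axioms vector_space_axioms)+
  fix t u :: "'c \<Rightarrow>\<^sub>0 'a" and r
  let ?K = "Poly_Mapping.keys t \<union> Poly_Mapping.keys u"
  have "lin_ext scale f (t + u) = (\<Sum>x\<in>?K. scale (Poly_Mapping.lookup (t + u) x) (f x))"
    by (rule lin_ext_superset) (auto dest: subsetD[OF keys_add])
  also have "\<dots> = lin_ext scale f t + lin_ext scale f u"
    by (simp add: lookup_add scale_left_distrib sum.distrib lin_ext_superset[of ?K])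
  finally show "lin_ext scale f (t + u) = lin_ext scale f t + lin_ext scale f u" .
  have "lin_ext scale f (fscale r t)
      = (\<Sum>x\<in>Poly_Mapping.keys t. scale (Poly_Mapping.lookup (fscale r t) x) (f x))"
    by (rule lin_ext_superset) (auto simp: in_keys_iff)
  then show "lin_ext scale f (fscale r t) = scale r (lin_ext scale f t)"
    by (simp add: lin_ext_def scale_sum_right)
qed

lemmas lin_ext_plus = linear_add[OF linear_lin_ext]
  and lin_ext_fscale = linear_scale[OF linear_lin_ext]
  and lin_ext_zero [simp] = linear_zero[OF linear_lin_ext]
  and lin_ext_minus = linear_diff[OF linear_lin_ext]
  and lin_ext_sum = linear_sum[OF linear_lin_ext]

lemma lin_ext_pure [simp]: "lin_ext scale f (pure x) = f x"
  by (simp add: lin_ext_def)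

lemma lin_ext_fbind: "lin_ext scale f (fbind t g) = lin_ext scale (\<lambda>x. lin_ext scale f (g x)) t"
  by (rule lin_ext_compose[OF linear_lin_ext])

lemma lin_ext_fmap: "lin_ext scale f (fmap g t) = lin_ext scale (\<lambda>x. f (g x)) t"
  by (simp add: lin_ext_fbind)

lemma lin_ext_add_fun: "lin_ext scale (\<lambda>x. f x + g x) t = lin_ext scale f t + lin_ext scale g t"
  by (simp add: lin_ext_def scale_right_distrib sum.distrib)

lemma lin_ext_scale_fun: "lin_ext scale (\<lambda>x. scale r (f x)) t = scale r (lin_ext scale f t)"
  by (simp add: lin_ext_def scale_sum_right mult.commute)

lemma lin_ext_zero_fun [simp]: "lin_ext scale (\<lambda>x. 0) t = 0"
  by (simp add: lin_ext_def)

lemma lin_ext_sum_fun: "lin_ext scale (\<lambda>x. \<Sum>b\<in>B. f b x) t = (\<Sum>b\<in>B. lin_ext scale (f b) t)"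
  by (induction B rule: infinite_finite_induct) (simp_all add: lin_ext_add_fun)

lemma lin_ext_swap:
  "lin_ext scale (\<lambda>x. lin_ext scale (\<lambda>y. f x y) u) t = lin_ext scale (\<lambda>y. lin_ext scale (\<lambda>x. f x y) t) u"
  by (simp add: lin_ext_def scale_sum_right mult.commute sum.swap[of _ "Poly_Mapping.keys u"])

lemma lin_ext_in_subspace:
  assumes "subspace X" "\<And>x. x \<in> Poly_Mapping.keys t \<Longrightarrow> f x \<in> X"
  shows "lin_ext scale f t \<in> X"
  unfolding lin_ext_def by (intro subspace_sum subspace_scale assms)

end

lemmas pairing_add = vector_space.lin_ext_plus[OF vector_space_field]
  and pairing_fscale = vector_space.lin_ext_fscale[OF vector_space_field]
  and pairing_zero [simp] = vector_space.lin_ext_zero[OF vector_space_field]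
  and pairing_diff = vector_space.lin_ext_minus[OF vector_space_field]
  and pairing_sum = vector_space.lin_ext_sum[OF vector_space_field]
  and pairing_pure [simp] = vector_space.lin_ext_pure[OF vector_space_field]
  and pairing_fbind = vector_space.lin_ext_fbind[OF vector_space_field]
  and pairing_fmap = vector_space.lin_ext_fmap[OF vector_space_field]
  and pairing_add_fun = vector_space.lin_ext_add_fun[OF vector_space_field]
  and pairing_scale_fun = vector_space.lin_ext_scale_fun[OF vector_space_field]
  and pairing_zero_fun [simp] = vector_space.lin_ext_zero_fun[OF vector_space_field]
  and pairing_sum_fun = vector_space.lin_ext_sum_fun[OF vector_space_field]
  and pairing_swap = vector_space.lin_ext_swap[OF vector_space_field]

lemma fbind_pure [simp]: "fbind t pure = t"
proof (rule poly_mapping_eqI)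
  fix x
  have "Poly_Mapping.lookup (fbind t pure) x
      = (\<Sum>y\<in>Poly_Mapping.keys t. Poly_Mapping.lookup t y * Poly_Mapping.lookup (pure y) x)"
    by (simp add: lin_ext_def lookup_sum)
  also have "\<dots> = (\<Sum>y\<in>Poly_Mapping.keys t. if y = x then Poly_Mapping.lookup t y else 0)"
    by (rule sum.cong) (auto simp: lookup_single when_def)
  also have "\<dots> = Poly_Mapping.lookup t x" by (simp add: sum.delta' in_keys_iff)
  finally show "Poly_Mapping.lookup (fbind t pure) x = Poly_Mapping.lookup t x" .
qed

lemma keys_fscale: "Poly_Mapping.keys (fscale r t) \<subseteq> Poly_Mapping.keys t"
  by (auto simp: in_keys_iff)

lemma subspace_keys: "formal.subspace {t. Poly_Mapping.keys t \<subseteq> K}"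
  unfolding formal.subspace_def using keys_fscale keys_add by (fastforce simp: subset_iff)

lemma keys_fbind:
  "(\<And>x. x \<in> Poly_Mapping.keys t \<Longrightarrow> Poly_Mapping.keys (g x) \<subseteq> K) \<Longrightarrow> Poly_Mapping.keys (fbind t g) \<subseteq> K"
  using formal.lin_ext_in_subspace[OF subspace_keys, of t g K] by simp

lemma keys_fmap: "Poly_Mapping.keys (fmap g t) \<subseteq> g ` Poly_Mapping.keys t"
  by (rule keys_fbind) auto

section \<open>Multilinear forms separate tensors\<close>

text \<open>Linearity is demanded on the carrier only: a form on a quotient may take any values on sets that
  are not cosets.\<close>

definition form_on :: "('k::field, 'v) vspace \<Rightarrow> ('v \<Rightarrow> 'k) \<Rightarrow> bool" where
  "form_on V f \<longleftrightarrow> (\<forall>v\<in>car V. \<forall>w\<in>car V. f (vadd V v w) = f v + f w) \<and>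
     (\<forall>r. \<forall>v\<in>car V. f (scl V r v) = r * f v)"

lemma form_on_full_space:
  "vector_space s \<Longrightarrow> form_on (full_space s) f \<longleftrightarrow> linear_form s f"
  by (simp add: form_on_def full_space_def Vector_Spaces.linear_iff vector_space_field)

lemma car_full_space [simp]: "car (full_space s) = UNIV"
  by (simp add: full_space_def)

text \<open>Relations in one slot are carried to relations in the same slot of longer tuples. This lets
  the tensor product of \<open>n + 1\<close> factors be treated as a first slot followed by \<open>n\<close> others.\<close>

lemma slot_rels_compose: "slot_rels V (\<lambda>v. j (c v)) = fmap j ` slot_rels V c"
proof -
  have image2: "f ` {e v w |v w. P v w} = {f (e v w) |v w. P v w}" for f e P
    by blast
  show ?thesis
    unfolding slot_rels_def image_Un image2
    by (simp add: formal.lin_ext_minus formal.lin_ext_fscale)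
qed

lemma pairing_slot_rels:
  assumes "r \<in> slot_rels V c" "form_on V (\<lambda>v. q (c v))"
  shows "pairing q r = 0"
  using assms by (auto simp: slot_rels_def form_on_def pairing_diff pairing_fscale)

lemma pairing_span:
  assumes "\<And>r. r \<in> R \<Longrightarrow> pairing q r = 0" "t \<in> formal.span R"
  shows "pairing q t = 0"
  using assms(2)
  by (induction rule: formal.span_induct_alt) (simp_all add: assms(1) pairing_add pairing_fscale)

lemma fmap_span:
  assumes "\<And>r. r \<in> R \<Longrightarrow> fmap j r \<in> formal.span R'" "t \<in> formal.span R"
  shows "fmap j t \<in> formal.span R'"
  using assms(2)
  by (induction rule: formal.span_induct_alt)
    (simp_all add: assms(1) formal.lin_ext_plus formal.lin_ext_fscale formal.span_add
      formal.span_scale formal.span_zero)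

definition expands_to :: "('x \<Rightarrow>\<^sub>0 'k::field) set \<Rightarrow> 'x \<Rightarrow> 'x set \<Rightarrow> ('x \<Rightarrow> 'k) \<Rightarrow> bool" where
  "expands_to R x P q \<longleftrightarrow> pure x - (\<Sum>p\<in>P. fscale (q p) (pure p)) \<in> formal.span R"

text \<open>Modulo \<open>R\<close>, the combination \<open>t\<close> equals the sum of its coordinates \<open>pairing (q p) t\<close> times
  the generators \<open>p\<close>.\<close>

lemma in_span_if_coordinates_vanish:
  assumes expand: "\<And>x. x \<in> Poly_Mapping.keys t \<Longrightarrow> expands_to R x P (\<lambda>p. q p x)"
    and zero: "\<And>p. p \<in> P \<Longrightarrow> pairing (q p) t = 0"
  shows "t \<in> formal.span R"
proof -
  have "t - (\<Sum>p\<in>P. fscale (pairing (q p) t) (pure p))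
      = fbind t (\<lambda>x. pure x - (\<Sum>p\<in>P. fscale (q p x) (pure p)))"
  proof -
    have "fbind t (\<lambda>x. (\<Sum>p\<in>P. fscale (q p x) (pure p))) = (\<Sum>p\<in>P. fscale (pairing (q p) t) (pure p))"
      unfolding formal.lin_ext_sum_fun
      by (simp add: lin_ext_def formal.scale_sum_left)
    moreover have "fbind t (\<lambda>x. pure x - g x) = t - fbind t g" for g
      using formal.lin_ext_add_fun[of "\<lambda>x. pure x - g x" g t] by (simp add: eq_diff_eq)
    ultimately show ?thesis by simp
  qed
  moreover have "\<dots> \<in> formal.span R"
    by (rule formal.lin_ext_in_subspace) (use expand in \<open>auto simp: expands_to_def\<close>)
  ultimately show ?thesis using zero by simp
qed

text \<open>A dual basis. The expansion \<open>v = \<Sum> \<beta> b v b\<close> is required in the free space modulo linearity,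
  the form in which it can be transported into a slot of a tensor product.\<close>

definition coordinates :: "('k::field, 'v) vspace \<Rightarrow> 'v set \<Rightarrow> ('v \<Rightarrow> 'v \<Rightarrow> 'k) \<Rightarrow> bool" where
  "coordinates V B \<beta> \<longleftrightarrow> finite B \<and> B \<subseteq> car V \<and> (\<forall>b\<in>B. form_on V (\<beta> b)) \<and>
     (\<forall>v\<in>car V. expands_to (slot_rels V (\<lambda>v. v)) v B (\<lambda>b. \<beta> b v))"

lemma fmap_expansion:
  "fmap j (pure x - (\<Sum>p\<in>P. fscale (q p) (pure p))) = pure (j x) - (\<Sum>p\<in>P. fscale (q p) (pure (j p)))"
  by (simp add: formal.lin_ext_minus formal.lin_ext_sum formal.lin_ext_fscale)

text \<open>The induction step for expanding a tuple into tuples of basis vectors: \<open>j v y\<close> puts the vector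
  \<open>v\<close> in front of the tuple \<open>y\<close>; the first slot is expanded by coordinates and the rest by the
  expansion of \<open>y\<close> that is already known. It serves for pairs, triples and words.\<close>

lemma expand_step:
  assumes V: "coordinates V B \<beta>" "v \<in> car V"
    and y: "expands_to R' y Q \<gamma>"
    and inj: "inj_on (\<lambda>(b, q). j b q) (B \<times> Q)"
    and slot: "slot_rels V (\<lambda>v. j v y) \<subseteq> R"
    and rest: "\<And>b r. b \<in> B \<Longrightarrow> r \<in> R' \<Longrightarrow> fmap (j b) r \<in> formal.span R"
    and \<delta>: "\<And>b q. b \<in> B \<Longrightarrow> q \<in> Q \<Longrightarrow> \<delta> (j b q) = \<beta> b v * \<gamma> q"
  shows "expands_to R (j v y) ((\<lambda>(b, q). j b q) ` (B \<times> Q)) \<delta>"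
proof -
  have "pure v - (\<Sum>b\<in>B. fscale (\<beta> b v) (pure b)) \<in> formal.span (slot_rels V (\<lambda>v. v))"
    using V by (simp add: coordinates_def expands_to_def)
  then have "fmap (\<lambda>v. j v y) (pure v - (\<Sum>b\<in>B. fscale (\<beta> b v) (pure b))) \<in> formal.span R"
    by (rule fmap_span[rotated])
      (use slot slot_rels_compose[of V "\<lambda>v. j v y" "\<lambda>v. v"] in \<open>auto intro: formal.span_base\<close>)
  then have "pure (j v y) - (\<Sum>b\<in>B. fscale (\<beta> b v) (pure (j b y))) \<in> formal.span R"
    by (simp only: fmap_expansion)
  moreover have "(\<Sum>b\<in>B. fscale (\<beta> b v) (pure (j b y) - (\<Sum>q\<in>Q. fscale (\<gamma> q) (pure (j b q)))))
      \<in> formal.span R"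
  proof (intro formal.span_sum formal.span_scale)
    fix b assume "b \<in> B"
    with y have "fmap (j b) (pure y - (\<Sum>q\<in>Q. fscale (\<gamma> q) (pure q))) \<in> formal.span R"
      unfolding expands_to_def by (blast intro: fmap_span rest)
    then show "pure (j b y) - (\<Sum>q\<in>Q. fscale (\<gamma> q) (pure (j b q))) \<in> formal.span R"
      by (simp only: fmap_expansion)
  qed
  moreover have "(\<Sum>p\<in>(\<lambda>(b, q). j b q) ` (B \<times> Q). fscale (\<delta> p) (pure p))
      = (\<Sum>b\<in>B. fscale (\<beta> b v) (\<Sum>q\<in>Q. fscale (\<gamma> q) (pure (j b q))))"
  proof -
    have "(\<Sum>p\<in>(\<lambda>(b, q). j b q) ` (B \<times> Q). fscale (\<delta> p) (pure p))
        = (\<Sum>(b, q)\<in>B \<times> Q. fscale (\<delta> (j b q)) (pure (j b q)))"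
      by (subst sum.reindex[OF inj]) (simp add: case_prod_unfold)
    also have "\<dots> = (\<Sum>b\<in>B. \<Sum>q\<in>Q. fscale (\<delta> (j b q)) (pure (j b q)))"
      by (rule sum.cartesian_product[symmetric])
    also have "\<dots> = (\<Sum>b\<in>B. \<Sum>q\<in>Q. fscale (\<beta> b v) (fscale (\<gamma> q) (pure (j b q))))"
      by (intro sum.cong refl) (simp add: \<delta>)
    finally show ?thesis by (simp only: formal.scale_sum_right)
  qed
  ultimately show ?thesis
    unfolding expands_to_def formal.scale_right_diff_distrib sum_subtractf
    using formal.span_add by fastforce
qed

lemma coset_eq_iff: "t +o formal.span R = u +o formal.span R \<longleftrightarrow> t - u \<in> formal.span R"
proof
  assume "t +o formal.span R = u +o formal.span R"
  moreover have "t \<in> t +o formal.span R" using formal.span_zero by (force simp: elt_set_plus_def)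
  ultimately show "t - u \<in> formal.span R" by (simp add: set_plus_imp_minus)
next
  assume tu: "t - u \<in> formal.span R"
  have "x - t \<in> formal.span R \<longleftrightarrow> x - u \<in> formal.span R" for x
    using formal.span_add[OF _ tu, of "x - t"] formal.span_diff[OF _ tu, of "x - u"] by auto
  then show "t +o formal.span R = u +o formal.span R"
    by (auto simp flip: set_minus_plus)
qed

definition bilinear_on where
  "bilinear_on V W h \<longleftrightarrow> (\<forall>w\<in>car W. form_on V (\<lambda>v. h v w)) \<and> (\<forall>v\<in>car V. form_on W (\<lambda>w. h v w))"

lemma pairing_rels2:
  assumes "bilinear_on V W h" "t \<in> formal.span (rels2 V W)"
  shows "pairing (\<lambda>(v, w). h v w) t = 0"
  using assms(2)
  by (rule pairing_span[rotated])
    (use assms(1) in \<open>auto simp: rels2_def bilinear_on_def intro: pairing_slot_rels\<close>)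

text \<open>This is the reason why the value of a bilinear expression in a representative of
  \<open>comul A a\<close>, hence every Sweedler sum, does not depend on the representative.\<close>

lemma pairing_tens2_cong:
  assumes "bilinear_on V W h" "tens2 V W t = tens2 V W u"
  shows "pairing (\<lambda>(v, w). h v w) t = pairing (\<lambda>(v, w). h v w) u"
  using pairing_rels2[OF assms(1), of "t - u"] assms(2) 
  by (simp add: tens2_def coset_eq_iff pairing_diff)

lemma form_on_times: "form_on V f \<Longrightarrow> form_on V (\<lambda>v. f v * c)"
  and form_on_times': "form_on V f \<Longrightarrow> form_on V (\<lambda>v. c * f v)"
  by (simp_all add: form_on_def algebra_simps)

lemma bilinear_on_times: "form_on V f \<Longrightarrow> form_on W g \<Longrightarrow> bilinear_on V W (\<lambda>v w. f v * g w)"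
  by (simp add: bilinear_on_def form_on_times form_on_times')

lemma coordinates_form_on: "coordinates V B \<beta> \<Longrightarrow> b \<in> B \<Longrightarrow> form_on V (\<beta> b)"
  and coordinates_expand: "coordinates V B \<beta> \<Longrightarrow> v \<in> car V \<Longrightarrow>
    expands_to (slot_rels V (\<lambda>v. v)) v B (\<lambda>b. \<beta> b v)"
  and coordinates_car: "coordinates V B \<beta> \<Longrightarrow> b \<in> B \<Longrightarrow> b \<in> car V"
  by (auto simp: coordinates_def)

lemma expands_rels2:
  assumes V: "coordinates V B \<beta>" and W: "coordinates W C \<gamma>" and v: "v \<in> car V" and w: "w \<in> car W"
  shows "expands_to (rels2 V W) (v, w) (B \<times> C) (\<lambda>(b, c). \<beta> b v * \<gamma> c w)"
proof -
  have "expands_to (rels2 V W) (v, w) ((\<lambda>(b, c). (b, c)) ` (B \<times> C)) (\<lambda>(b, c). \<beta> b v * \<gamma> c w)"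
  proof (rule expand_step[OF V v coordinates_expand[OF W w]])
    show "slot_rels V (\<lambda>v. (v, w)) \<subseteq> rels2 V W" using w by (auto simp: rels2_def)
    fix b r assume b: "b \<in> B" and r: "r \<in> slot_rels W (\<lambda>v. v)"
    then have "fmap (Pair b) r \<in> slot_rels W (\<lambda>w. (b, w))"
      unfolding slot_rels_compose[of W "Pair b" "\<lambda>v. v"] by blast
    then show "fmap (Pair b) r \<in> formal.span (rels2 V W)"
      using coordinates_car[OF V b] by (auto simp: rels2_def intro!: formal.span_base)
  qed (auto simp: inj_on_def)
  then show ?thesis by simp
qed

text \<open>If all products of forms agree, then in particular the products of coordinate forms do, and
  these are the coordinates of a tensor with respect to the pairs of basis vectors.\<close>

lemma tens2_eq_iff:
  assumes V: "coordinates V B \<beta>" and W: "coordinates W C \<gamma>"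
    and t: "Poly_Mapping.keys t \<subseteq> car V \<times> car W" and u: "Poly_Mapping.keys u \<subseteq> car V \<times> car W"
  shows "tens2 V W t = tens2 V W u \<longleftrightarrow> (\<forall>f g. form_on V f \<longrightarrow> form_on W g \<longrightarrow>
    pairing (\<lambda>(v, w). f v * g w) t = pairing (\<lambda>(v, w). f v * g w) u)"
    (is "_ \<longleftrightarrow> ?R")
proof
  assume "tens2 V W t = tens2 V W u"
  then show ?R using pairing_tens2_cong bilinear_on_times by blast
next
  assume R: ?R
  have keys: "Poly_Mapping.keys (t - u) \<subseteq> car V \<times> car W"
    by (rule order_trans[OF keys_diff Un_least[OF t u]])
  have "t - u \<in> formal.span (rels2 V W)"
  proof (rule in_span_if_coordinates_vanish)
    fix x assume "x \<in> Poly_Mapping.keys (t - u)"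
    then show "expands_to (rels2 V W) x (B \<times> C) (\<lambda>p. (\<lambda>(b, c) (v, w). \<beta> b v * \<gamma> c w) p x)"
      using keys expands_rels2[OF V W] by (cases x) (fastforce simp: case_prod_unfold)
  next
    fix p assume "p \<in> B \<times> C"
    then obtain b c where "p = (b, c)" "form_on V (\<beta> b)" "form_on W (\<gamma> c)"
      using coordinates_form_on[OF V] coordinates_form_on[OF W] by blast
    then show "pairing ((\<lambda>(b, c) (v, w). \<beta> b v * \<gamma> c w) p) (t - u) = 0"
      using R by (simp add: pairing_diff)
  qed
  then show "tens2 V W t = tens2 V W u" by (simp add: tens2_def coset_eq_iff)
qed

definition trilinear_on where
  "trilinear_on U V W h \<longleftrightarrow> (\<forall>v\<in>car V. \<forall>w\<in>car W. form_on U (\<lambda>u. h u v w)) \<and>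
    (\<forall>u\<in>car U. bilinear_on V W (h u))"

lemma pairing_tens3_cong:
  assumes "trilinear_on U V W h" "tens3 U V W t = tens3 U V W u"
  shows "pairing (\<lambda>(u, v, w). h u v w) t = pairing (\<lambda>(u, v, w). h u v w) u"
proof -
  have "t - u \<in> formal.span (rels3 U V W)" using assms(2) by (simp add: tens3_def coset_eq_iff)
  then have "pairing (\<lambda>(u, v, w). h u v w) (t - u) = 0"
    by (rule pairing_span[rotated])
      (use assms(1) in \<open>auto simp: rels3_def trilinear_on_def bilinear_on_def intro: pairing_slot_rels\<close>)
  then show ?thesis by (simp add: pairing_diff)
qed

lemma trilinear_on_times:
  "form_on U f \<Longrightarrow> form_on V g \<Longrightarrow> form_on W h \<Longrightarrow> trilinear_on U V W (\<lambda>u v w. f u * (g v * h w))"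
  by (simp add: trilinear_on_def bilinear_on_def form_on_times form_on_times')

lemma expands_rels3:
  assumes U: "coordinates U A \<alpha>" and V: "coordinates V B \<beta>" and W: "coordinates W C \<gamma>"
    and u: "u \<in> car U" and v: "v \<in> car V" and w: "w \<in> car W"
  shows "expands_to (rels3 U V W) (u, v, w) (A \<times> B \<times> C) (\<lambda>(a, b, c). \<alpha> a u * (\<beta> b v * \<gamma> c w))"
proof -
  have "expands_to (rels3 U V W) (u, v, w) ((\<lambda>(b, c). (b, c)) ` (A \<times> B \<times> C))
    (\<lambda>(a, b, c). \<alpha> a u * (\<beta> b v * \<gamma> c w))"
  proof (rule expand_step[OF U u expands_rels2[OF V W v w]])
    show "slot_rels U (\<lambda>u. (u, v, w)) \<subseteq> rels3 U V W" using v w by (auto simp: rels3_def)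
    fix a r assume a: "a \<in> A" and r: "r \<in> rels2 V W"
    then have "fmap (Pair a) r \<in> (\<Union>w\<in>car W. slot_rels V (\<lambda>v. (a, v, w)))
        \<union> (\<Union>v\<in>car V. slot_rels W (\<lambda>w. (a, v, w)))"
      unfolding rels2_def
      using slot_rels_compose[of V "Pair a" "\<lambda>v. (v, _)"] slot_rels_compose[of W "Pair a" "\<lambda>w. (_, w)"]
      by fastforce
    then show "fmap (Pair a) r \<in> formal.span (rels3 U V W)"
      using coordinates_car[OF U a] by (auto simp: rels3_def intro!: formal.span_base)
  qed (auto simp: inj_on_def)
  then show ?thesis by simp
qed

lemma tens3_eq_iff:
  assumes U: "coordinates U A \<alpha>" and V: "coordinates V B \<beta>" and W: "coordinates W C \<gamma>"
    and t: "Poly_Mapping.keys t \<subseteq> car U \<times> car V \<times> car W"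
    and u: "Poly_Mapping.keys u \<subseteq> car U \<times> car V \<times> car W"
  shows "tens3 U V W t = tens3 U V W u \<longleftrightarrow>
    (\<forall>f g h. form_on U f \<longrightarrow> form_on V g \<longrightarrow> form_on W h \<longrightarrow>
      pairing (\<lambda>(u, v, w). f u * (g v * h w)) t = pairing (\<lambda>(u, v, w). f u * (g v * h w)) u)"
    (is "_ \<longleftrightarrow> ?R")
proof
  assume "tens3 U V W t = tens3 U V W u"
  then show ?R using pairing_tens3_cong trilinear_on_times by blast
next
  assume R: ?R
  have keys: "Poly_Mapping.keys (t - u) \<subseteq> car U \<times> car V \<times> car W"
    by (rule order_trans[OF keys_diff Un_least[OF t u]])
  have "t - u \<in> formal.span (rels3 U V W)"
  proof (rule in_span_if_coordinates_vanish)
    fix x assume "x \<in> Poly_Mapping.keys (t - u)"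
    then show "expands_to (rels3 U V W) x (A \<times> B \<times> C)
        (\<lambda>p. (\<lambda>(a, b, c) (u, v, w). \<alpha> a u * (\<beta> b v * \<gamma> c w)) p x)"
      using keys expands_rels3[OF U V W] by (cases x) (fastforce simp: case_prod_unfold)
  next
    fix p assume "p \<in> A \<times> B \<times> C"
    then obtain a b c where "p = (a, b, c)" "form_on U (\<alpha> a)" "form_on V (\<beta> b)" "form_on W (\<gamma> c)"
      using coordinates_form_on[OF U] coordinates_form_on[OF V] coordinates_form_on[OF W] by blast
    then show "pairing ((\<lambda>(a, b, c) (u, v, w). \<alpha> a u * (\<beta> b v * \<gamma> c w)) p) (t - u) = 0"
      using R by (simp add: pairing_diff)
  qed
  then show "tens3 U V W t = tens3 U V W u" by (simp add: tens3_def coset_eq_iff)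
qed

text \<open>The form \<open>\<phi>\<^sub>1 \<otimes> \<dots> \<otimes> \<phi>\<^sub>n\<close> on words of length \<open>n\<close>.\<close>

fun tensor_form :: "('v \<Rightarrow> 'k::field) list \<Rightarrow> 'v list \<Rightarrow> 'k" where
  "tensor_form (\<phi> # \<phi>s) (w # ws) = \<phi> w * tensor_form \<phi>s ws"
| "tensor_form \<phi>s ws = 1"

lemma rels_powI:
  assumes "r \<in> slot_rels V (\<lambda>v. xs @ v # ys)" "xs \<in> lists (car V)" "ys \<in> lists (car V)"
  shows "r \<in> rels_pow V (length xs + length ys + 1)"
  unfolding rels_pow_def by (rule UN_I[of "(xs, ys)"]) (use assms in auto)

lemma expands_rels_pow:
  assumes V: "coordinates V B \<beta>" and ws: "ws \<in> lists (car V)"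
  shows "expands_to (rels_pow V (length ws)) ws {bs. set bs \<subseteq> B \<and> length bs = length ws}
    (\<lambda>bs. tensor_form (map \<beta> bs) ws)"
  using ws
proof (induction ws)
  case Nil
  have "{bs. set bs \<subseteq> B \<and> length bs = length []} = {[]}" by auto
  then show ?case by (simp add: expands_to_def formal.span_zero)
next
  case (Cons w ws)
  let ?n = "length ws"
  have words: "(\<lambda>(b, bs). b # bs) ` (B \<times> {bs. set bs \<subseteq> B \<and> length bs = ?n})
      = {bs. set bs \<subseteq> B \<and> length bs = length (w # ws)}"
    by (auto simp: image_iff length_Suc_conv)
  have "expands_to (rels_pow V (Suc ?n)) (w # ws)
     ((\<lambda>(b, bs). b # bs) ` (B \<times> {bs. set bs \<subseteq> B \<and> length bs = ?n}))
     (\<lambda>bs. tensor_form (map \<beta> bs) (w # ws))"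
  proof (rule expand_step[OF V _ Cons.IH])
    show "w \<in> car V" "inj_on (\<lambda>(b, bs). b # bs) (B \<times> {bs. set bs \<subseteq> B \<and> length bs = ?n})"
      using Cons.hyps by (auto simp: inj_on_def)
    show "slot_rels V (\<lambda>v. v # ws) \<subseteq> rels_pow V (Suc ?n)"
      using rels_powI[of _ V "[]" ws] Cons.hyps by auto
    fix b r assume b: "b \<in> B" and "r \<in> rels_pow V ?n"
    then obtain xs ys where xy: "xs \<in> lists (car V)" "ys \<in> lists (car V)" "length xs + length ys + 1 = ?n"
      and r: "r \<in> slot_rels V (\<lambda>v. xs @ v # ys)" by (auto simp: rels_pow_def)
    from r have "fmap (Cons b) r \<in> slot_rels V (\<lambda>v. (b # xs) @ v # ys)"
      using slot_rels_compose[of V "Cons b" "\<lambda>v. xs @ v # ys"] by auto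
    then have "fmap (Cons b) r \<in> rels_pow V (length (b # xs) + length ys + 1)"
      using xy coordinates_car[OF V b] by (intro rels_powI) auto
    then show "fmap (Cons b) r \<in> formal.span (rels_pow V (Suc ?n))"
      using xy(3) by (auto intro: formal.span_base)
  qed simp
  then show ?case unfolding words by simp
qed

lemma in_span_rels_pow:
  assumes V: "coordinates V B \<beta>"
    and keys: "Poly_Mapping.keys t \<subseteq> {ws. ws \<in> lists (car V) \<and> length ws = n}"
    and zero: "\<And>\<phi>s. length \<phi>s = n \<Longrightarrow> \<forall>\<phi>\<in>set \<phi>s. form_on V \<phi> \<Longrightarrow> pairing (tensor_form \<phi>s) t = 0"
  shows "t \<in> formal.span (rels_pow V n)"
proof (rule in_span_if_coordinates_vanish)
  fix ws assume "ws \<in> Poly_Mapping.keys t"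
  then show "expands_to (rels_pow V n) ws {bs. set bs \<subseteq> B \<and> length bs = n}
      (\<lambda>bs. tensor_form (map \<beta> bs) ws)"
    using keys expands_rels_pow[OF V] by blast
next
  fix bs assume "bs \<in> {bs. set bs \<subseteq> B \<and> length bs = n}"
  then show "pairing (tensor_form (map \<beta> bs)) t = 0"
    using coordinates_form_on[OF V] by (intro zero) auto
qed

lemma form_on_tensor_form:
  assumes "\<forall>\<phi>\<in>set \<phi>s. form_on V \<phi>" "length \<phi>s = length xs + length ys + 1"
  shows "form_on V (\<lambda>v. tensor_form \<phi>s (xs @ v # ys))"
  using assms
proof (induction xs arbitrary: \<phi>s)
  case Nil
  then show ?case by (cases \<phi>s) (auto simp: form_on_times)
next
  case (Cons x xs)
  then show ?case by (cases \<phi>s) (auto simp: form_on_times')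
qed

lemma pairing_rels_pow:
  assumes h: "\<And>xs ys. length xs + length ys + 1 = n \<Longrightarrow> form_on V (\<lambda>v. h (xs @ v # ys))"
    and t: "t \<in> formal.span (rels_pow V n)"
  shows "pairing h t = 0"
  using t by (rule pairing_span[rotated]) (auto simp: rels_pow_def intro!: pairing_slot_rels h)

section \<open>Finite-dimensional spaces and their quotients\<close>

text \<open>For a form \<open>f\<close> that vanishes on \<open>N\<close>, this is the form on the quotient by \<open>N\<close> through
  which \<open>f\<close> factors.\<close>

definition coset_form :: "('v \<Rightarrow> 'k) \<Rightarrow> 'v set \<Rightarrow> 'k" where
  "coset_form f X = f (SOME x. x \<in> X)"

context vector_space
begin

lemma pure_linear_combination:
  assumes "finite K"
  shows "pure (\<Sum>b\<in>K. scale (r b) (g b)) - (\<Sum>b\<in>K. fscale (r b) (pure (g b)))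
    \<in> formal.span (slot_rels (full_space scale) (\<lambda>v. v))"
    (is "_ \<in> formal.span ?S")
proof -
  have plus: "pure (v + w) - pure v - pure w \<in> ?S" for v w
    by (auto simp: slot_rels_def full_space_def)
  have scl: "pure (scale c v) - fscale c (pure v) \<in> ?S" for c v
    by (auto simp: slot_rels_def full_space_def)
  show ?thesis
    using assms
  proof (induction K)
    case empty
    have "pure (0 + 0) - pure 0 - pure 0 \<in> ?S" by (rule plus)
    then have "- pure 0 \<in> formal.span ?S" using formal.span_base by force
    then have "pure 0 \<in> formal.span ?S" using formal.span_neg by fastforce
    then show ?case by simp
  next
    case (insert b K)
    let ?x = "scale (r b) (g b)" and ?y = "\<Sum>b\<in>K. scale (r b) (g b)"
    have "pure (?x + ?y) - pure ?x - pure ?y \<in> ?S" "pure ?x - fscale (r b) (pure (g b)) \<in> ?S"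
      by (fact plus scl)+
    from formal.span_add[OF formal.span_add[OF this[THEN formal.span_base]] insert.IH]
    show ?case using insert.hyps by (simp add: algebra_simps)
  qed
qed

lemma coordinates_full_space:
  assumes "finite D" "independent D" "span D = UNIV"
  shows "coordinates (full_space scale) D (\<lambda>b v. representation D v b)"
  unfolding coordinates_def expands_to_def
proof (intro conjI ballI)
  fix b show "form_on (full_space scale) (\<lambda>v. representation D v b)"
    using linear_representation[OF assms(2,3)] by (simp add: form_on_full_space vector_space_axioms)
next
  fix v
  have "(\<Sum>b\<in>D. scale (representation D v b) b) = v"
    using assms by (intro sum_representation_eq) auto
  with pure_linear_combination[OF assms(1), of "representation D v" "\<lambda>b. b"]
  show "pure v - (\<Sum>p\<in>D. fscale (representation D v p) (pure p))
      \<in> formal.span (slot_rels (full_space scale) (\<lambda>v. v))" by simp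
qed (use assms in auto)

text \<open>A basis adapted to a subspace. Forms that read off the coordinates outside \<open>C\<close> vanish on \<open>X\<close>;
  this is how annihilators of subspaces are produced below.\<close>

lemma adapted_basis:
  assumes "\<exists>Basis. finite_dimensional_vector_space scale Basis" "subspace X"
  obtains C D where "C \<subseteq> D" "finite D" "independent D" "span D = UNIV" "span C = X"
proof -
  from assms(1) obtain Basis where "finite_dimensional_vector_space scale Basis" by blast
  then interpret fd: finite_dimensional_vector_space scale Basis .
  obtain C where "C \<subseteq> X" "independent C" "X \<subseteq> span C" by (rule basis_exists)
  then show ?thesis
    using assms(2) extend_basis_superset[of C] independent_extend_basis[of C] span_extend_basis[of C]
      fd.finiteI_independent span_subspace
    by (intro that[of C "extend_basis C"]) auto
qed

lemma representation_outside:
  assumes "independent D" "C \<subseteq> D" "x \<in> span C" "d \<notin> C"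
  shows "representation D x d = 0"
  using representation_extend[OF assms(1,3,2)] representation_ne_zero[of C x d] assms(4) by metis

lemma linear_form_expand:
  assumes "finite D" "independent D" "span D = UNIV" "linear_form scale f"
  shows "f v = (\<Sum>b\<in>D. representation D v b * f b)"
proof -
  have "v = (\<Sum>b\<in>D. scale (representation D v b) b)"
    using sum_representation_eq[of D v D] assms by auto
  then have "f v = f (\<Sum>b\<in>D. scale (representation D v b) b)" by simp
  then show ?thesis by (simp add: linear_sum[OF assms(4)] linear_scale[OF assms(4)])
qed

lemma linear_form_representation:
  "independent D \<Longrightarrow> span D = UNIV \<Longrightarrow> linear_form scale (\<lambda>v. representation D v b)"
  by (rule linear_representation)

lemma linear_form_separates_subspace:
  assumes fd: "\<exists>Basis. finite_dimensional_vector_space scale Basis" and X: "subspace X"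
    and v: "\<And>f. linear_form scale f \<Longrightarrow> \<forall>x\<in>X. f x = 0 \<Longrightarrow> f v = 0"
  shows "v \<in> X"
proof -
  obtain C D where D: "C \<subseteq> D" "finite D" "independent D" "span D = UNIV" "span C = X"
    using adapted_basis[OF fd X] .
  have "representation D v d = 0" if "d \<notin> C" for d
    using representation_outside[OF D(3,1) _ that] D(5)
    by (intro v linear_form_representation D) auto
  then have "(\<Sum>b\<in>D. scale (representation D v b) b) \<in> span C"
    by (intro span_sum) (metis scale_zero_left span_base span_scale span_zero)
  then show ?thesis using sum_representation_eq[of D v D] D by auto
qed

text \<open>Only the subspace \<open>E\<close> is of finite dimension. In the application to the antipode the ambient
  space consists of all functions from \<open>A\<close> to itself.\<close>

lemma injective_on_subspace_imp_surjective:
  assumes "finite T" "E \<subseteq> span T" "subspace E" and L: "Vector_Spaces.linear scale scale L"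
    and LE: "L ` E \<subseteq> E" and inj: "\<And>x. x \<in> E \<Longrightarrow> L x = 0 \<Longrightarrow> x = 0"
  shows "L ` E = E"
proof -
  interpret L: Vector_Spaces.linear scale scale L by (fact L)
  obtain b where b: "b \<subseteq> E" "independent b" "E \<subseteq> span b" by (rule basis_exists)
  have sb: "span b = E" using b assms(3) by (simp add: span_subspace)
  have injE: "inj_on L (span b)"
    unfolding sb
  proof (rule inj_onI)
    fix x y assume "x \<in> E" "y \<in> E" "L x = L y"
    then show "x = y" using inj[of "x - y"] assms(3) by (simp add: subspace_diff L.diff)
  qed
  have fin: "finite b" using independent_span_bound[OF assms(1) b(2)] b(1) assms(2) by auto
  have Lb: "independent (L ` b)" using b(2) injE by (rule L.independent_injective_image)
  have "E \<subseteq> span (L ` b)"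
  proof (rule ccontr)
    assume "\<not> E \<subseteq> span (L ` b)"
    then obtain x where x: "x \<in> E" "x \<notin> span (L ` b)" by blast
    have "card (insert x (L ` b)) \<le> card b"
      using independent_span_bound[OF fin independent_insertI[OF x(2) Lb]] x(1) b(1) LE sb by auto
    moreover have "x \<notin> L ` b" using x(2) span_base by blast
    moreover have "card (L ` b) = card b"
      using injE span_superset by (intro card_image) (metis inj_on_subset)
    ultimately show False using fin by simp
  qed
  also have "span (L ` b) = L ` E" using L.span_image[of b] sb by simp
  finally show ?thesis using LE by blast
qed

lemma coset_add:
  assumes "subspace N"
  shows "(v +o N) + (w +o N) = (v + w) +o N"
proof -
  have "N + N = N"
    using assms subspace_0[OF assms] subspace_add[OF assms]
    by (auto simp: set_plus_def) (metis add.right_neutral)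
  then show ?thesis by (simp add: set_plus_rearrange)
qed

lemma coset_scale_coset:
  assumes "subspace N"
  shows "coset_scale scale N c (v +o N) = scale c v +o N"
proof -
  have "scale c ` (v +o N) + N = scale c v +o N"
  proof (intro set_eqI iffI)
    fix x assume "x \<in> scale c ` (v +o N) + N"
    then obtain n m where "n \<in> N" "m \<in> N" "x = scale c (v + n) + m"
      by (auto simp: set_plus_def elt_set_plus_def)
    then show "x \<in> scale c v +o N"
      using subspace_add[OF assms subspace_scale[OF assms]]
      by (auto simp: elt_set_plus_def scale_right_distrib add.assoc)
  next
    fix x assume "x \<in> scale c v +o N"
    then obtain n where n: "n \<in> N" "x = scale c v + n" by (auto simp: elt_set_plus_def)
    moreover have "v \<in> v +o N" using subspace_0[OF assms] by (force simp: elt_set_plus_def)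
    ultimately show "x \<in> scale c ` (v +o N) + N" by blast
  qed
  then show ?thesis by (simp add: coset_scale_def)
qed

lemma coset_of_member:
  assumes "subspace N" "n \<in> N"
  shows "n +o N = 0 +o N"
  using subspace_add[OF assms] subspace_diff[OF assms(1) _ assms(2)]
  by (auto simp: elt_set_plus_def) (metis add.commute diff_add_cancel)

lemma form_on_quotient_space:
  assumes N: "subspace N" and g: "form_on (quotient_space scale N) g"
  shows "linear_form scale (\<lambda>v. g (v +o N))" "n \<in> N \<Longrightarrow> g (n +o N) = 0"
proof -
  have add: "g ((v + w) +o N) = g (v +o N) + g (w +o N)" for v w
    using g unfolding form_on_def quotient_space_def by (simp flip: coset_add[OF N])
  have scl: "g (scale r v +o N) = r * g (v +o N)" for r v
    using g unfolding form_on_def quotient_space_def by (simp flip: coset_scale_coset[OF N])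
  show "linear_form scale (\<lambda>v. g (v +o N))"
    by (rule linear_formI) (simp_all add: add scl vector_space_axioms)
  show "g (n +o N) = 0" if "n \<in> N"
    using scl[of 0 0] coset_of_member[OF N that] by simp
qed

lemma coset_form_coset:
  assumes N: "subspace N" and f: "linear_form scale f" "\<forall>n\<in>N. f n = 0"
  shows "coset_form f (v +o N) = f v"
proof -
  have "v \<in> v +o N" using subspace_0[OF N] by (force simp: elt_set_plus_def)
  then have "(SOME x. x \<in> v +o N) \<in> v +o N" by (rule someI)
  then obtain n where "n \<in> N" "(SOME x. x \<in> v +o N) = v + n" by (auto simp: elt_set_plus_def)
  then show ?thesis using f by (simp add: coset_form_def linear_add)
qed

lemma form_on_coset_form:
  assumes N: "subspace N" and f: "linear_form scale f" "\<forall>n\<in>N. f n = 0"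
  shows "form_on (quotient_space scale N) (coset_form f)"
  unfolding form_on_def quotient_space_def
  by (auto simp: coset_add[OF N] coset_scale_coset[OF N] coset_form_coset[OF assms]
      linear_add[OF f(1)] linear_scale[OF f(1)])

text \<open>Extend a basis \<open>C\<close> of \<open>N\<close> to a basis \<open>D\<close> of the whole space. The cosets of \<open>D - C\<close> are a basis
  of the quotient, and the coordinate forms of \<open>D - C\<close> vanish on \<open>N\<close>, hence factor through it.\<close>

lemma coordinates_quotient_space:
  assumes fd: "\<exists>Basis. finite_dimensional_vector_space scale Basis" and N: "subspace N"
  shows "\<exists>B \<beta>. coordinates (quotient_space scale N) B \<beta>"
proof -
  obtain C D where D: "C \<subseteq> D" "finite D" "independent D" "span D = UNIV" "span C = N"
    using adapted_basis[OF fd N] .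
  let ?Q = "quotient_space scale N" and ?p = "\<lambda>v. v +o N"
  let ?x = "\<lambda>d v. representation D v d"
  let ?S = "formal.span (slot_rels ?Q (\<lambda>v. v))"
  have x: "linear_form scale (?x d)" "\<forall>n\<in>N. ?x d n = 0" if "d \<in> D - C" for d
    using representation_outside[OF D(3,1), of _ d] D(5) that linear_form_representation[OF D(3,4)]
    by auto
  note lift = coset_form_coset[OF N x]
  have inj: "inj_on ?p (D - C)"
  proof (rule inj_onI)
    fix d e assume de: "d \<in> D - C" "e \<in> D - C" "?p d = ?p e"
    then have "?x d d = ?x d e" using lift by metis
    then show "d = e" using representation_basis[OF D(3), of d] representation_basis[OF D(3), of e] de
      by (auto split: if_splits)
  qed
  define \<beta> where "\<beta> b = coset_form (?x (inv_into (D - C) ?p b))" for b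
  have \<beta>: "\<beta> (?p d) = coset_form (?x d)" if "d \<in> D - C" for d
    using inv_into_f_f[OF inj that] by (simp add: \<beta>_def)
  have slot: "fmap ?p r \<in> ?S" if "r \<in> slot_rels (full_space scale) (\<lambda>v. v)" for r
  proof (rule formal.span_base)
    have "fmap ?p r \<in> slot_rels (full_space scale) ?p"
      using slot_rels_compose[of "full_space scale" ?p "\<lambda>v. v"] that by blast
    then show "fmap ?p r \<in> slot_rels ?Q (\<lambda>v. v)"
      unfolding slot_rels_def quotient_space_def full_space_def
      by (fastforce simp flip: coset_add[OF N] coset_scale_coset[OF N])
  qed
  have zero: "pure (?p n) \<in> ?S" if "n \<in> N" for n
  proof -
    have "pure 0 \<in> formal.span (slot_rels (full_space scale) (\<lambda>v. v))"
      using pure_linear_combination[of "{}" "\<lambda>_. 0" "\<lambda>b. b"] by simp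
    from fmap_span[OF slot this] have "pure (?p 0) \<in> ?S" by (simp only: formal.lin_ext_pure)
    then show ?thesis using coset_of_member[OF N that] by simp
  qed
  have "coordinates ?Q (?p ` (D - C)) \<beta>"
    unfolding coordinates_def
  proof (intro conjI ballI)
    show "finite (?p ` (D - C))" using D(2) by simp
    show "?p ` (D - C) \<subseteq> car ?Q" by (auto simp: quotient_space_def)
    show "form_on ?Q (\<beta> b)" if "b \<in> ?p ` (D - C)" for b
      using that \<beta> form_on_coset_form[OF N x] by auto
    fix X assume "X \<in> car ?Q"
    then obtain v where X: "X = ?p v" by (auto simp: quotient_space_def)
    have "(\<Sum>d\<in>D. scale (?x d v) d) = v"
      using sum_representation_eq[of D v D] D by auto
    with pure_linear_combination[OF D(2), of "\<lambda>d. ?x d v" "\<lambda>d. d"]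
    have "pure v - (\<Sum>d\<in>D. fscale (?x d v) (pure d))
        \<in> formal.span (slot_rels (full_space scale) (\<lambda>v. v))" by simp
    from fmap_span[OF slot this]
    have "pure X - (\<Sum>d\<in>D. fscale (?x d v) (pure (?p d))) \<in> ?S"
      by (simp only: fmap_expansion X)
    moreover have "(\<Sum>d\<in>C. fscale (?x d v) (pure (?p d))) \<in> ?S"
      using D(5) span_base by (intro formal.span_sum formal.span_scale zero) auto
    moreover have "(\<Sum>d\<in>D. fscale (?x d v) (pure (?p d)))
        = (\<Sum>d\<in>D - C. fscale (?x d v) (pure (?p d))) + (\<Sum>d\<in>C. fscale (?x d v) (pure (?p d)))"
      using D by (intro sum.subset_diff)
    ultimately have "pure X - (\<Sum>d\<in>D - C. fscale (?x d v) (pure (?p d))) \<in> ?S"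
      using formal.span_add by fastforce
    moreover have "(\<Sum>b\<in>?p ` (D - C). fscale (\<beta> b X) (pure b))
        = (\<Sum>d\<in>D - C. fscale (?x d v) (pure (?p d)))"
      by (simp add: sum.reindex[OF inj] \<beta> lift X)
    ultimately show "expands_to (slot_rels ?Q (\<lambda>v. v)) X (?p ` (D - C)) (\<lambda>b. \<beta> b X)"
      by (simp add: expands_to_def)
  qed
  then show ?thesis by blast
qed

end

section \<open>Tensors over subspaces\<close>

lemma tens2_add: "tens2 V W t + tens2 V W u = tens2 V W (t + u)"
  unfolding tens2_def by (rule formal.coset_add) (rule formal.subspace_span)

lemma tens2_scale:
  "coset_scale fscale (formal.span (rels2 V W)) c (tens2 V W t) = tens2 V W (fscale c t)"
  unfolding tens2_def by (rule formal.coset_scale_coset) (rule formal.subspace_span)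

abbreviation bilinear_form ::
    "('k::field \<Rightarrow> 'v::ab_group_add \<Rightarrow> 'v) \<Rightarrow> ('v \<Rightarrow> 'v \<Rightarrow> 'k) \<Rightarrow> bool" where
  "bilinear_form s \<equiv> bilinear_on (full_space s) (full_space s)"

abbreviation tensor ::
    "('k::field \<Rightarrow> 'v::ab_group_add \<Rightarrow> 'v) \<Rightarrow> ('v \<times> 'v \<Rightarrow>\<^sub>0 'k) \<Rightarrow> ('v \<times> 'v \<Rightarrow>\<^sub>0 'k) set" where
  "tensor s \<equiv> tens2 (full_space s) (full_space s)"

text \<open>The second factors in the unique expansion \<open>t = \<Sum> b \<otimes> y\<^sub>b\<close> along a basis \<open>D\<close> of the first
  factor: \<open>slice s D b t\<close> is \<open>y\<^sub>b\<close>.\<close>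

definition slice ::
    "('k::field \<Rightarrow> 'v::ab_group_add \<Rightarrow> 'v) \<Rightarrow> 'v set \<Rightarrow> 'v \<Rightarrow> ('v \<times> 'v \<Rightarrow>\<^sub>0 'k) \<Rightarrow> 'v" where
  "slice s D b t = lin_ext s (\<lambda>(x, y). s (module.representation s D x b) y) t"

context vector_space
begin

lemma bilinear_form_iff:
  fixes h :: "'b \<Rightarrow> 'b \<Rightarrow> 'a"
  shows "bilinear_form scale h \<longleftrightarrow> (\<forall>y. linear_form scale (\<lambda>x. h x y)) \<and> (\<forall>x. linear_form scale (h x))"
  by (simp add: bilinear_on_def form_on_full_space[OF vector_space_axioms])

lemma bilinear_formI:
  fixes h :: "'b \<Rightarrow> 'b \<Rightarrow> 'a"
  shows "(\<And>y. linear_form scale (\<lambda>x. h x y)) \<Longrightarrow> (\<And>x. linear_form scale (\<lambda>y. h x y)) \<Longrightarrow> bilinear_form scale h"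
  by (simp add: bilinear_form_iff)

lemma linear_form_times: "linear_form scale f \<Longrightarrow> linear_form scale (\<lambda>x. f x * c)"
  and linear_form_times': "linear_form scale f \<Longrightarrow> linear_form scale (\<lambda>x. c * f x)"
  by (auto simp: Vector_Spaces.linear_iff algebra_simps)

lemma bilinear_form_times: "linear_form scale f \<Longrightarrow> linear_form scale g \<Longrightarrow> bilinear_form scale (\<lambda>x y. f x * g y)"
  by (simp add: bilinear_form_iff linear_form_times linear_form_times')

context
  fixes D assumes D: "finite D" "independent D" "span D = UNIV"
begin

lemma tensor_eq_iff:
  "tensor scale t = tensor scale u \<longleftrightarrow> (\<forall>f g. linear_form scale f \<longrightarrow> linear_form scale g \<longrightarrow>
    pairing (\<lambda>(v, w). f v * g w) t = pairing (\<lambda>(v, w). f v * g w) u)"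
  using tens2_eq_iff[OF coordinates_full_space[OF D] coordinates_full_space[OF D], of t u]
  by (simp add: form_on_full_space[OF vector_space_axioms])

lemma linear_form_slice:
  "linear_form scale g \<Longrightarrow> g (slice scale D b t) = pairing (\<lambda>(x, y). representation D x b * g y) t"
  unfolding slice_def
  by (simp add: lin_ext_compose[of scale "(*)" g] case_prod_unfold linear_scale)

lemma tensor_slices: "tensor scale t = tensor scale (\<Sum>b\<in>D. pure (b, slice scale D b t))"
  unfolding tensor_eq_iff
proof (intro allI impI)
  fix f g assume f: "linear_form scale f" and g: "linear_form scale g"
  have "pairing (\<lambda>(v, w). f v * g w) (\<Sum>b\<in>D. pure (b, slice scale D b t))
      = (\<Sum>b\<in>D. f b * pairing (\<lambda>(x, y). representation D x b * g y) t)"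
    by (simp add: pairing_sum linear_form_slice[OF g])
  also have "\<dots> = pairing (\<lambda>p. \<Sum>b\<in>D. f b * (case p of (x, y) \<Rightarrow> representation D x b * g y)) t"
    by (simp add: pairing_sum_fun pairing_scale_fun)
  also have "(\<lambda>p. \<Sum>b\<in>D. f b * (case p of (x, y) \<Rightarrow> representation D x b * g y)) = (\<lambda>(v, w). f v * g w)"
  proof (intro ext, clarify)
    fix v w
    have "(\<Sum>b\<in>D. f b * (representation D v b * g w)) = (\<Sum>b\<in>D. representation D v b * f b) * g w"
      by (simp add: sum_distrib_left sum_distrib_right mult_ac)
    then show "(\<Sum>b\<in>D. f b * (representation D v b * g w)) = f v * g w"
      by (simp only: linear_form_expand[OF D f, of v])
  qed
  finally show "pairing (\<lambda>(v, w). f v * g w) t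
      = pairing (\<lambda>(v, w). f v * g w) (\<Sum>b\<in>D. pure (b, slice scale D b t))" by simp
qed

end

text \<open>Write \<open>t = \<Sum> b \<otimes> y\<^sub>b\<close> along a basis adapted to \<open>X\<close>. The terms with \<open>b\<close> in \<open>X\<close> belong to
  \<open>X \<otimes> V\<close>; for the others the coordinate form of \<open>b\<close> vanishes on \<open>X\<close>, so all \<open>g\<close> that vanish
  on \<open>Y\<close> kill \<open>y\<^sub>b\<close>, that is, \<open>y\<^sub>b\<close> lies in \<open>Y\<close>. This yields the coideal property of \<open>I\<close>.\<close>

lemma in_tensor_image_sum:
  assumes fd: "\<exists>Basis. finite_dimensional_vector_space scale Basis" and X: "subspace X" and Y: "subspace Y"
    and zero: "\<And>f g. linear_form scale f \<Longrightarrow> linear_form scale g \<Longrightarrow> \<forall>x\<in>X. f x = 0 \<Longrightarrow> \<forall>y\<in>Y. g y = 0 \<Longrightarrow>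
      pairing (\<lambda>(x, y). f x * g y) t = 0"
  shows "tensor scale t \<in> tensor_image (full_space scale) (full_space scale) X UNIV
    + tensor_image (full_space scale) (full_space scale) UNIV Y"
proof -
  obtain C D where D: "C \<subseteq> D" "finite D" "independent D" "span D = UNIV" "span C = X"
    using adapted_basis[OF fd X] .
  note D' = D(2-4)
  have Y': "slice scale D b t \<in> Y" if "b \<in> D - C" for b
  proof (rule linear_form_separates_subspace[OF fd Y])
    fix g assume "linear_form scale g" "\<forall>y\<in>Y. g y = 0"
    then show "g (slice scale D b t) = 0"
      using that D(5) representation_outside[OF D(3,1)] linear_form_representation[OF D(3,4)]
      by (simp add: linear_form_slice[OF D'] zero)
  qed
  have "tensor scale t
      = tensor scale ((\<Sum>b\<in>D - C. pure (b, slice scale D b t)) + (\<Sum>b\<in>C. pure (b, slice scale D b t)))"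
    by (simp only: tensor_slices[OF D', of t] flip: sum.subset_diff[OF D(1,2)])
  also have "\<dots> = tensor scale (\<Sum>b\<in>C. pure (b, slice scale D b t))
      + tensor scale (\<Sum>b\<in>D - C. pure (b, slice scale D b t))"
    by (simp add: tens2_add add.commute)
  also have "\<dots> \<in> tensor_image (full_space scale) (full_space scale) X UNIV
    + tensor_image (full_space scale) (full_space scale) UNIV Y"
  proof (rule set_plus_intro; unfold tensor_image_def; rule imageI; rule CollectI)
    show "Poly_Mapping.keys (\<Sum>b\<in>C. pure (b, slice scale D b t)) \<subseteq> X \<times> UNIV"
      using keys_sum[of "\<lambda>b. pure (b, slice scale D b t)" C] D(5) span_base[of _ C] by fastforce
    show "Poly_Mapping.keys (\<Sum>b\<in>D - C. pure (b, slice scale D b t)) \<subseteq> UNIV \<times> Y"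
      using keys_sum[of "\<lambda>b. pure (b, slice scale D b t)" "D - C"] Y' by fastforce
  qed
  finally show ?thesis .
qed

text \<open>The equality \<open>(X \<otimes> V) \<inter> (V \<otimes> Y) = X \<otimes> Y\<close> in dual form, by the same expansion: now \<open>y\<^sub>b = 0\<close> for
  \<open>b\<close> outside \<open>X\<close>, and all \<open>y\<^sub>b\<close> lie in \<open>Y\<close>. It yields the subcoalgebra property of the Hopf
  kernel.\<close>

lemma in_tensor_image:
  assumes fd: "\<exists>Basis. finite_dimensional_vector_space scale Basis" and X: "subspace X" and Y: "subspace Y"
    and left: "\<And>f g. linear_form scale f \<Longrightarrow> linear_form scale g \<Longrightarrow> \<forall>x\<in>X. f x = 0 \<Longrightarrow>
      pairing (\<lambda>(x, y). f x * g y) t = 0"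
    and right: "\<And>f g. linear_form scale f \<Longrightarrow> linear_form scale g \<Longrightarrow> \<forall>y\<in>Y. g y = 0 \<Longrightarrow>
      pairing (\<lambda>(x, y). f x * g y) t = 0"
  shows "tensor scale t \<in> tensor_image (full_space scale) (full_space scale) X Y"
proof -
  obtain C D where D: "C \<subseteq> D" "finite D" "independent D" "span D = UNIV" "span C = X"
    using adapted_basis[OF fd X] .
  note D' = D(2-4)
  let ?x = "\<lambda>b v. representation D v b"
  have x: "linear_form scale (?x b)" for b by (rule linear_form_representation[OF D(3,4)])
  have Y': "slice scale D b t \<in> Y" for b
    by (rule linear_form_separates_subspace[OF fd Y]) (simp add: linear_form_slice[OF D'] right x)
  have zero: "slice scale D b t = 0" if "b \<in> D - C" for b
  proof -
    have "slice scale D b t \<in> {0}"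
      using that D(5) representation_outside[OF D(3,1)] x
      by (intro linear_form_separates_subspace[OF fd]) (auto simp: linear_form_slice[OF D'] left)
    then show ?thesis by simp
  qed
  have "tensor scale t = tensor scale (\<Sum>b\<in>C. pure (b, slice scale D b t))"
    unfolding tensor_slices[OF D', of t] unfolding tensor_eq_iff[OF D'] pairing_sum
    using D(1,2) by (auto intro!: sum.mono_neutral_right simp: zero linear_zero)
  moreover have "Poly_Mapping.keys (\<Sum>b\<in>C. pure (b, slice scale D b t)) \<subseteq> X \<times> Y"
    using keys_sum[of "\<lambda>b. pure (b, slice scale D b t)" C] D(5) span_base[of _ C] Y' by fastforce
  ultimately show ?thesis by (auto simp: tensor_image_def)
qed

end

section \<open>Sweedler sums and convolution\<close>

text \<open>\<open>sweedler A h a\<close> is \<open>\<Sum> h(a\<^sub>1, a\<^sub>2)\<close>; it depends only on the tensor \<open>comul A a\<close> if \<open>h\<close> is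
  bilinear.\<close>

definition sweedler ::
    "('k::field, 'a::ring_1) hopf \<Rightarrow> ('a \<Rightarrow> 'a \<Rightarrow> 'k) \<Rightarrow> 'a \<Rightarrow> 'k" where
  "sweedler A h a = pairing (\<lambda>(x, y). h x y) (sw2 A a)"

definition convolution ::
    "('k::field, 'a::ring_1) hopf \<Rightarrow> ('a \<Rightarrow> 'k) \<Rightarrow> ('a \<Rightarrow> 'k) \<Rightarrow> 'a \<Rightarrow> 'k" where
  "convolution A f g = sweedler A (\<lambda>x y. f x * g y)"

lemma sweedler_add: "sweedler A (\<lambda>x y. h x y + h' x y) a = sweedler A h a + sweedler A h' a"
  by (simp add: sweedler_def case_prod_unfold pairing_add_fun)

lemma sweedler_scale: "sweedler A (\<lambda>x y. r * h x y) a = r * sweedler A h a"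
  by (simp add: sweedler_def case_prod_unfold pairing_scale_fun)

lemma sweedler_scale_right: "sweedler A (\<lambda>x y. h x y * r) a = sweedler A h a * r"
  using sweedler_scale[of A r h a] by (simp add: mult.commute)

lemma sweedler_zero [simp]: "sweedler A (\<lambda>x y. 0) a = 0"
  by (simp add: sweedler_def case_prod_unfold)

lemma sweedler_swap:
  "sweedler A (\<lambda>x y. sweedler B (\<lambda>u v. h x y u v) b) a = sweedler B (\<lambda>u v. sweedler A (\<lambda>x y. h x y u v) a) b"
  by (simp add: sweedler_def case_prod_unfold pairing_swap[of _ "sw2 B b"])

lemma linear_form_sweedler_args:
  assumes "vector_space s" "\<And>x y. linear_form s (\<lambda>m. h m x y)"
  shows "linear_form s (\<lambda>m. sweedler A (h m) a)"
proof (rule linear_formI[OF assms(1)])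
  fix v w r
  have "h (v + w) = (\<lambda>x y. h v x y + h w x y)" "h (s r v) = (\<lambda>x y. r * h v x y)"
    by (simp_all add: fun_eq_iff linear_add[OF assms(2)] linear_scale[OF assms(2)])
  then show "sweedler A (h (v + w)) a = sweedler A (h v) a + sweedler A (h w) a"
    "sweedler A (h (s r v)) a = r * sweedler A (h v) a"
    by (simp_all add: sweedler_add sweedler_scale)
qed

text \<open>The two actions of \<open>A\<^sup>*\<close> on \<open>A\<close>. They are adjoint to convolution with \<open>f\<close> on either side, so a statement about all values \<open>(f * g)(a)\<close> with \<open>g\<close> varying becomes
  one about a single vector of \<open>A\<close>.\<close>

definition hit_left :: "('k::field, 'a::ring_1) hopf \<Rightarrow> ('a \<Rightarrow> 'k) \<Rightarrow> 'a \<Rightarrow> 'a" where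
  "hit_left A f a = lin_ext (hscale A) (\<lambda>(x, y). hscale A (f x) y) (sw2 A a)"

definition hit_right :: "('k::field, 'a::ring_1) hopf \<Rightarrow> ('a \<Rightarrow> 'k) \<Rightarrow> 'a \<Rightarrow> 'a" where
  "hit_right A g a = lin_ext (hscale A) (\<lambda>(x, y). hscale A (g y) x) (sw2 A a)"

context k_coalgebra
begin

lemma comul_tensor: "comul A a = tensor (hscale A) (sw2 A a)"
proof -
  obtain t where t: "comul A a = tensor (hscale A) t" using comul_closed by (auto simp: tensor_image_def)
  have "t + 0 \<in> tensor (hscale A) t" unfolding tens2_def by (intro set_plus_intro2 formal.span_zero)
  then have "sw2 A a \<in> tensor (hscale A) t" unfolding sw2_def rep_def t by (metis someI)
  then have "sw2 A a - t \<in> formal.span (rels2 (hspace A) (hspace A))"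
    by (simp add: tens2_def set_plus_imp_minus)
  then show ?thesis by (simp add: t tens2_def flip: coset_eq_iff)
qed

lemma sweedler_representative:
  "bilinear_form (hscale A) h \<Longrightarrow> comul A a = tensor (hscale A) t \<Longrightarrow> sweedler A h a = pairing (\<lambda>(x, y). h x y) t"
  unfolding sweedler_def comul_tensor by (rule pairing_tens2_cong)

lemma linear_form_sweedler:
  assumes h: "bilinear_form (hscale A) h"
  shows "linear_form (hscale A) (sweedler A h)"
proof (rule linear_formI[OF vector_space_axioms])
  fix a b r
  have "comul A (a + b) = tensor (hscale A) (sw2 A a + sw2 A b)"
    using comul_add[of a b] by (simp only: comul_tensor tens2_add)
  then show "sweedler A h (a + b) = sweedler A h a + sweedler A h b"
    by (simp add: sweedler_representative[OF h] pairing_add) (simp add: sweedler_def)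
  have "comul A (hscale A r a) = tensor (hscale A) (fscale r (sw2 A a))"
    using comul_scale[of r a] by (simp only: comul_tensor tens2_scale)
  then show "sweedler A h (hscale A r a) = r * sweedler A h a"
    by (simp add: sweedler_representative[OF h] pairing_fscale) (simp add: sweedler_def)
qed

lemma linear_form_counit: "linear_form (hscale A) (counit A)"
  by (rule counit_linear)

lemma sweedler_counit_left:
  assumes "linear_form (hscale A) f" shows "sweedler A (\<lambda>x y. counit A x * f y) a = f a"
proof -
  have "f a = f (lin_ext (hscale A) (\<lambda>(x, y). hscale A (counit A x) y) (sw2 A a))" by (simp add: counit_left)
  then show ?thesis
    by (simp add: lin_ext_compose[OF assms] sweedler_def case_prod_unfold linear_scale[OF assms])
qed

lemma sweedler_counit_right:
  assumes "linear_form (hscale A) f" shows "sweedler A (\<lambda>x y. counit A y * f x) a = f a"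
proof -
  have "f a = f (lin_ext (hscale A) (\<lambda>(x, y). hscale A (counit A y) x) (sw2 A a))" by (simp add: counit_right)
  then show ?thesis
    by (simp add: lin_ext_compose[OF assms] sweedler_def case_prod_unfold linear_scale[OF assms])
qed

lemma sweedler_coassoc:
  assumes "\<And>v w. linear_form (hscale A) (\<lambda>u. h u v w)" "\<And>u w. linear_form (hscale A) (\<lambda>v. h u v w)"
    "\<And>u v. linear_form (hscale A) (\<lambda>w. h u v w)"
  shows "sweedler A (\<lambda>x y. sweedler A (\<lambda>u v. h u v y) x) a
    = sweedler A (\<lambda>x y. sweedler A (\<lambda>u v. h x u v) y) a"
proof -
  have "trilinear_on (hspace A) (hspace A) (hspace A) h"
    using assms by (simp add: trilinear_on_def bilinear_on_def form_on_full_space[OF vector_space_axioms])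
  from pairing_tens3_cong[OF this coassoc, of a]
  show ?thesis
    unfolding pairing_fbind sweedler_def by (simp add: case_prod_unfold pairing_fmap)
qed

lemma linear_form_convolution:
  "linear_form (hscale A) f \<Longrightarrow> linear_form (hscale A) g \<Longrightarrow> linear_form (hscale A) (convolution A f g)"
  unfolding convolution_def by (intro linear_form_sweedler bilinear_form_times)

lemma convolution_assoc:
  assumes "linear_form (hscale A) f" "linear_form (hscale A) g" "linear_form (hscale A) h"
  shows "convolution A (convolution A f g) h = convolution A f (convolution A g h)"
proof
  fix a
  have "sweedler A (\<lambda>x y. sweedler A (\<lambda>u v. f u * (g v * h y)) x) a
      = sweedler A (\<lambda>x y. sweedler A (\<lambda>u v. f x * (g u * h v)) y) a"
    by (rule sweedler_coassoc) (simp_all add: assms linear_form_times linear_form_times')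
  then show "convolution A (convolution A f g) h a = convolution A f (convolution A g h) a"
    by (simp add: convolution_def sweedler_scale mult.assoc flip: sweedler_scale_right)
qed

lemma convolution_counit:
  assumes "linear_form (hscale A) f"
  shows "convolution A (counit A) f = f" "convolution A f (counit A) = f"
  using sweedler_counit_left[OF assms] sweedler_counit_right[OF assms]
  by (auto simp: convolution_def mult.commute)

lemma linear_form_hit_left: "linear_form (hscale A) g \<Longrightarrow> g (hit_left A f a) = convolution A f g a"
  by (simp add: hit_left_def convolution_def sweedler_def lin_ext_compose[of "hscale A" "(*)" g]
      case_prod_unfold linear_scale)

lemma linear_form_hit_right: "linear_form (hscale A) f \<Longrightarrow> f (hit_right A g a) = convolution A f g a"
  by (simp add: hit_right_def convolution_def sweedler_def lin_ext_compose[of "hscale A" "(*)" f]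
      case_prod_unfold linear_scale mult.commute)

end

context k_bialgebra
begin

lemma linear_mult_left: "Vector_Spaces.linear (hscale A) (hscale A) (\<lambda>x. x * y)"
  and linear_mult_right: "Vector_Spaces.linear (hscale A) (hscale A) (\<lambda>y. x * y)"
  by (auto simp: Vector_Spaces.linear_iff vector_space_axioms algebra_simps
      scale_mult_left scale_mult_right)

lemma linear_form_compose:
  "Vector_Spaces.linear (hscale A) (hscale A) h \<Longrightarrow> linear_form (hscale A) f \<Longrightarrow> linear_form (hscale A) (\<lambda>x. f (h x))"
  by (simp add: Vector_Spaces.linear_iff)

lemma linear_form_mult:
  assumes "linear_form (hscale A) f"
  shows "linear_form (hscale A) (\<lambda>x. f (x * y))" "linear_form (hscale A) (\<lambda>y. f (x * y))"
  using assms by (auto intro: linear_form_compose linear_mult_left linear_mult_right)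

lemma sweedler_mult:
  assumes h: "bilinear_form (hscale A) h"
  shows "sweedler A h (a * b) = sweedler A (\<lambda>x y. sweedler A (\<lambda>u v. h (x * u) (y * v)) b) a"
  unfolding sweedler_representative[OF h comul_mult] pairing_fbind
  by (simp add: sweedler_def case_prod_unfold pairing_fmap)

lemma sweedler_one: "bilinear_form (hscale A) h \<Longrightarrow> sweedler A h 1 = h 1 1"
  using sweedler_representative[OF _ comul_one, of h] by simp

lemma convolution_mult:
  assumes "linear_form (hscale A) f" "linear_form (hscale A) g"
  shows "convolution A f g (a * b)
    = sweedler A (\<lambda>x y. sweedler A (\<lambda>u v. f (x * u) * g (y * v)) b) a"
  unfolding convolution_def by (rule sweedler_mult) (intro bilinear_form_times assms)

lemma convolution_one:
  "linear_form (hscale A) f \<Longrightarrow> linear_form (hscale A) g \<Longrightarrow> convolution A f g 1 = f 1 * g 1"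
  by (simp add: convolution_def sweedler_one bilinear_form_times)

end

section \<open>Bi-ideals and the antipode\<close>

lemma vector_space_fun:
  assumes "vector_space s" shows "vector_space (\<lambda>c h x. s c (h x))"
proof -
  interpret vector_space s by fact
  show ?thesis
    by unfold_locales (auto simp: fun_eq_iff scale_right_distrib scale_left_distrib)
qed

lemma sum_apply: "(\<Sum>i\<in>K. f i) x = (\<Sum>i\<in>K. f i x)"
  by (induction K rule: infinite_finite_induct) simp_all

lemma (in vector_space) linear_forms_separate:
  assumes "\<exists>Basis. finite_dimensional_vector_space scale Basis"
    and "\<And>f. linear_form scale f \<Longrightarrow> f v = f w"
  shows "v = w"
proof -
  have "v - w \<in> {0}"
    using assms by (intro linear_form_separates_subspace) (auto simp: linear_diff)
  then show ?thesis by simp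
qed

lemma (in vector_space) linear_endomorphisms_finite_span:
  assumes fd: "\<exists>Basis. finite_dimensional_vector_space scale Basis"
  obtains T where "finite T"
    "{h. Vector_Spaces.linear scale scale h} \<subseteq> module.span (\<lambda>c h x. scale c (h x)) T"
proof -
  interpret F: vector_space "\<lambda>c h x. scale c (h x)" by (rule vector_space_fun[OF vector_space_axioms])
  obtain C D where D: "C \<subseteq> D" "finite D" "independent D" "span D = UNIV" "span C = {0}"
    using adapted_basis[OF fd subspace_single_0] .
  let ?e = "\<lambda>b d v. scale (representation D v b) d"
  let ?T = "(\<lambda>(b, d). ?e b d) ` (D \<times> D)"
  have "h \<in> F.span ?T" if h: "Vector_Spaces.linear scale scale h" for h
  proof -
    have *: "(\<Sum>d\<in>D. scale (representation D v d) d) = v" for v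
      using sum_representation_eq[of D v D] D by auto
    have hv: "h v = (\<Sum>b\<in>D. \<Sum>d\<in>D. scale (representation D (h b) d) (?e b d v))" for v
    proof -
      have "h v = h (\<Sum>b\<in>D. scale (representation D v b) b)" by (simp add: *)
      also have "\<dots> = (\<Sum>b\<in>D. scale (representation D v b) (h b))"
        by (simp add: linear_sum[OF h] linear_scale[OF h])
      also have "\<dots> = (\<Sum>b\<in>D. scale (representation D v b) (\<Sum>d\<in>D. scale (representation D (h b) d) d))"
        by (simp add: *)
      finally show ?thesis by (simp add: scale_sum_right mult.commute)
    qed
    have "h = (\<Sum>b\<in>D. \<Sum>d\<in>D. (\<lambda>v. scale (representation D (h b) d) (?e b d v)))"
      by (rule ext) (unfold sum_apply, rule hv)
    also have "\<dots> \<in> F.span ?T"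
      by (intro F.span_sum F.span_scale F.span_base) auto
    finally show ?thesis .
  qed
  then show ?thesis using D(2) by (intro that[of ?T]) auto
qed

context hopf_algebra
begin

text \<open>Let \<open>E\<close> be the space of endomorphisms of \<open>A\<close> that map \<open>I\<close> to itself. Because \<open>I\<close> is an ideal
  and a coideal, \<open>L h = \<Sum> a\<^sub>1 h(a\<^sub>2)\<close> again belongs to \<open>E\<close>. Convolving with \<open>S\<close> on the left undoes
  \<open>L\<close>, so \<open>L\<close> is injective on \<open>E\<close> and by finite dimension onto. The map \<open>a \<mapsto> \<epsilon>(a) 1\<close> is in \<open>E\<close>, and
  the only candidate for its preimage is \<open>S\<close>.\<close>

lemma antipode_stable:
  assumes fd: "\<exists>Basis. finite_dimensional_vector_space (hscale A) Basis"
    and I: "subspace I" and ideal: "\<And>a x. x \<in> I \<Longrightarrow> a * x \<in> I" "\<And>a x. x \<in> I \<Longrightarrow> x * a \<in> I"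
    and coideal: "\<And>x. x \<in> I \<Longrightarrow> comul A x \<in>
        tensor_image (hspace A) (hspace A) I UNIV + tensor_image (hspace A) (hspace A) UNIV I"
    and counit0: "\<And>x. x \<in> I \<Longrightarrow> counit A x = 0"
    and x: "x \<in> I"
  shows "antipode A x \<in> I"
proof -
  interpret F: vector_space "\<lambda>c h x. hscale A c (h x)" by (rule vector_space_fun[OF vector_space_axioms])
  define L where "L h a = lin_ext (hscale A) (\<lambda>(x, y). x * h y) (sw2 A a)" for h a
  define E where "E = {h. Vector_Spaces.linear (hscale A) (hscale A) h \<and> h ` I \<subseteq> I}"
  have L: "f (L h a) = sweedler A (\<lambda>x y. f (x * h y)) a" if "linear_form (hscale A) f" for f h a
    unfolding L_def sweedler_def by (simp add: lin_ext_compose[OF that] case_prod_unfold)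
  have bil: "bilinear_form (hscale A) (\<lambda>x y. f (x * h y))"
    if "Vector_Spaces.linear (hscale A) (hscale A) h" "linear_form (hscale A) f" for f h
    using that
    by (intro bilinear_formI linear_form_mult linear_form_compose[OF that(1), of "\<lambda>z. f (_ * z)"])
  \<comment> \<open>The convolution \<open>S * (id * h) = h\<close>, tested by a form.\<close>
  have key: "sweedler A (\<lambda>x y. f (antipode A x * L h y)) a = f (h a)"
    if h: "Vector_Spaces.linear (hscale A) (hscale A) h" and f: "linear_form (hscale A) f" for f h a
  proof -
    have "sweedler A (\<lambda>x y. f (antipode A x * L h y)) a
        = sweedler A (\<lambda>x y. sweedler A (\<lambda>u v. f (antipode A x * (u * h v))) y) a"
      by (simp add: L[OF linear_form_mult(2)[OF f]])
    also have "\<dots> = sweedler A (\<lambda>x y. sweedler A (\<lambda>u v. f (antipode A u * (v * h y))) x) a"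
      by (rule sweedler_coassoc[symmetric])
        (auto intro!: linear_form_compose[OF antipode_linear, of "\<lambda>z. f (z * _)"]
          linear_form_compose[OF h, of "\<lambda>z. f (_ * (_ * z))"] linear_form_mult linear_form_mult[of "\<lambda>z. f (_ * z)"] f)
    also have "(\<lambda>x y. sweedler A (\<lambda>u v. f (antipode A u * (v * h y))) x) = (\<lambda>x y. counit A x * f (h y))"
    proof (intro ext)
      fix x y
      have "sweedler A (\<lambda>u v. f (antipode A u * v * h y)) x
          = f (lin_ext (hscale A) (\<lambda>(u, v). antipode A u * v) (sw2 A x) * h y)"
        unfolding sweedler_def
        by (simp add: lin_ext_compose[OF linear_form_mult(1)[OF f]] case_prod_unfold)
      then show "sweedler A (\<lambda>u v. f (antipode A u * (v * h y))) x = counit A x * f (h y)"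
        by (simp add: antipode_left scale_mult_left linear_scale[OF f] mult.assoc)
    qed
    finally show ?thesis by (simp add: sweedler_counit_left linear_form_compose[OF h f])
  qed
  obtain T where T: "finite T" "{h. Vector_Spaces.linear (hscale A) (hscale A) h} \<subseteq> F.span T"
    using linear_endomorphisms_finite_span[OF fd] .
  have "L ` E = E"
  proof (rule F.injective_on_subspace_imp_surjective[OF T(1)])
    show "E \<subseteq> F.span T" using T(2) by (auto simp: E_def)
    show "F.subspace E"
      unfolding F.subspace_def E_def
      using subspace_0[OF I] subspace_add[OF I] subspace_scale[OF I]
      by (auto simp: Vector_Spaces.linear_iff vector_space_axioms scale_right_distrib mult.commute
          image_subset_iff algebra_simps)
    show "Vector_Spaces.linear (\<lambda>c h x. hscale A c (h x)) (\<lambda>c h x. hscale A c (h x)) L"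
      unfolding Vector_Spaces.linear_iff L_def
      by (simp add: F.vector_space_axioms fun_eq_iff distrib_left scale_mult_right case_prod_unfold
          lin_ext_add_fun lin_ext_scale_fun)
    show "L ` E \<subseteq> E"
    proof
      fix k assume "k \<in> L ` E"
      then obtain h where k: "k = L h" and h: "Vector_Spaces.linear (hscale A) (hscale A) h" "h ` I \<subseteq> I"
        by (auto simp: E_def)
      have "Vector_Spaces.linear (hscale A) (hscale A) k"
        unfolding Vector_Spaces.linear_iff
        by (auto simp: vector_space_axioms k linear_add linear_scale L
            linear_add[OF linear_form_sweedler[OF bil[OF h(1)]]]
            linear_scale[OF linear_form_sweedler[OF bil[OF h(1)]]] intro!: linear_forms_separate[OF fd])
      moreover have "k x \<in> I" if x: "x \<in> I" for x
      proof (rule linear_form_separates_subspace[OF fd I])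
        fix f assume f: "linear_form (hscale A) f" "\<forall>x\<in>I. f x = 0"
        obtain t u where tu: "comul A x = tensor (hscale A) (t + u)"
          "Poly_Mapping.keys t \<subseteq> I \<times> UNIV" "Poly_Mapping.keys u \<subseteq> UNIV \<times> I"
          using coideal[OF x] unfolding tensor_image_def by (elim set_plus_elim imageE) (auto simp: tens2_add)
        have "pairing (\<lambda>(x, y). f (x * h y)) t = pairing (\<lambda>_. 0) t"
        proof (rule lin_ext_cong, clarify)
          fix y z assume "(y, z) \<in> Poly_Mapping.keys t"
          then have "y \<in> I" using tu(2) by blast
          then show "f (y * h z) = 0" using f(2) ideal(2) by blast
        qed
        moreover have "pairing (\<lambda>(x, y). f (x * h y)) u = pairing (\<lambda>_. 0) u"
        proof (rule lin_ext_cong, clarify)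
          fix y z assume "(y, z) \<in> Poly_Mapping.keys u"
          then have "h z \<in> I" using tu(3) h(2) by blast
          then show "f (y * h z) = 0" using f(2) ideal(1) by blast
        qed
        ultimately show "f (k x) = 0"
          by (simp add: k L[OF f(1)] sweedler_representative[OF bil[OF h(1) f(1)] tu(1)] pairing_add)
      qed
      ultimately show "k \<in> E" by (auto simp: E_def)
    qed
    fix h assume h: "h \<in> E" and 0: "L h = 0"
    show "h = 0"
    proof
      fix a show "h a = 0 a"
        using key[of h _ a] h 0 by (intro linear_forms_separate[OF fd]) (simp add: E_def linear_zero)
    qed
  qed
  moreover have "(\<lambda>a. hscale A (counit A a) 1) \<in> E"
    using subspace_0[OF I]
    by (auto simp: E_def counit0 Vector_Spaces.linear_iff vector_space_axioms scale_left_distrib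
        linear_add[OF linear_form_counit] linear_scale[OF linear_form_counit])
  ultimately have "(\<lambda>a. hscale A (counit A a) 1) \<in> L ` E" by simp
  then obtain h where h: "Vector_Spaces.linear (hscale A) (hscale A) h" "h ` I \<subseteq> I"
    and Lh: "L h = (\<lambda>a. hscale A (counit A a) 1)"
    unfolding E_def by (elim imageE CollectE conjE) simp
  have "h a = antipode A a" for a
  proof (rule linear_forms_separate[OF fd])
    fix f assume f: "linear_form (hscale A) f"
    show "f (h a) = f (antipode A a)"
      using sweedler_counit_right[OF linear_form_compose[OF antipode_linear f]]
      by (simp add: Lh scale_mult_right linear_scale[OF f] flip: key[OF h(1) f])
  qed
  then show ?thesis using h(2) x by auto
qed

end

section \<open>Matrix coefficients of tensor powers\<close>

definition matrix_coefficient :: "('a \<Rightarrow> 'm \<Rightarrow> 'm) \<Rightarrow> 'm \<Rightarrow> ('m \<Rightarrow> 'k) \<Rightarrow> 'a \<Rightarrow> 'k" where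
  "matrix_coefficient act m \<phi> a = \<phi> (act a m)"

text \<open>For vectors \<open>m\<^sub>1, \<dots>, m\<^sub>n\<close> and forms \<open>\<phi>\<^sub>1, \<dots>, \<phi>\<^sub>n\<close> this is the matrix coefficient of \<open>M\<^sup>\<otimes>\<^sup>n\<close> at
  \<open>m\<^sub>1 \<otimes> \<dots> \<otimes> m\<^sub>n\<close> and \<open>\<phi>\<^sub>1 \<otimes> \<dots> \<otimes> \<phi>\<^sub>n\<close>, see \<open>pairing_diag_word\<close>.\<close>

fun word_coefficient ::
    "('k::field, 'a::ring_1) hopf \<Rightarrow> ('a \<Rightarrow> 'm \<Rightarrow> 'm) \<Rightarrow> ('m \<times> ('m \<Rightarrow> 'k)) list \<Rightarrow> 'a \<Rightarrow> 'k" where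
  "word_coefficient A act [] = counit A"
| "word_coefficient A act ((m, \<phi>) # l) =
     convolution A (matrix_coefficient act m \<phi>) (word_coefficient A act l)"

text \<open>The algebra \<open>D\<close>, that is, the unital subalgebra of \<open>A\<^sup>*\<close> generated by the
  matrix coefficients of \<open>M\<close>. Products are only formed with a generator on the left, which makes
  induction easy; closure under all products is \<open>conv_coefficients\<close>.\<close>

inductive_set coefficient_algebra ::
    "('k::field, 'a::ring_1) hopf \<Rightarrow> ('k \<Rightarrow> 'm::ab_group_add \<Rightarrow> 'm) \<Rightarrow> ('a \<Rightarrow> 'm \<Rightarrow> 'm) \<Rightarrow> ('a \<Rightarrow> 'k) set"
  for A sM act where
  unit: "counit A \<in> coefficient_algebra A sM act"
| step: "linear_form sM \<phi> \<Longrightarrow> g \<in> coefficient_algebra A sM act \<Longrightarrow>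
     convolution A (matrix_coefficient act m \<phi>) g \<in> coefficient_algebra A sM act"
| add: "g \<in> coefficient_algebra A sM act \<Longrightarrow> h \<in> coefficient_algebra A sM act \<Longrightarrow>
     (\<lambda>a. g a + h a) \<in> coefficient_algebra A sM act"
| scale: "g \<in> coefficient_algebra A sM act \<Longrightarrow> (\<lambda>a. r * g a) \<in> coefficient_algebra A sM act"

lemma keys_slot_rels:
  fixes r :: "'x \<Rightarrow>\<^sub>0 'k::field"
  assumes "r \<in> slot_rels V c" "\<And>v. c v \<in> K"
  shows "Poly_Mapping.keys r \<subseteq> K"
proof -
  define X :: "('x \<Rightarrow>\<^sub>0 'k) set" where "X = {t. Poly_Mapping.keys t \<subseteq> K}"
  have X: "formal.subspace X" unfolding X_def by (rule subspace_keys)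
  have "pure (c v) \<in> X" for v using assms(2) by (simp add: X_def)
  then have "r \<in> X"
    using assms(1) unfolding slot_rels_def
    by (auto intro!: formal.subspace_diff formal.subspace_scale X)
  then show ?thesis by (simp add: X_def)
qed

lemma pairing_diag_word:
  "length \<phi>s = length ms \<Longrightarrow>
    pairing (tensor_form \<phi>s) (diag_word A act ms a) = word_coefficient A act (zip ms \<phi>s) a"
proof (induction ms arbitrary: \<phi>s a)
  case Nil
  then show ?case by (simp add: lin_ext_def)
next
  case (Cons m ms)
  then obtain \<phi> \<phi>s' where \<phi>s: "\<phi>s = \<phi> # \<phi>s'" "length \<phi>s' = length ms" by (cases \<phi>s) auto
  show ?case
    by (simp add: \<phi>s pairing_fbind pairing_fmap case_prod_unfold pairing_scale_fun Cons.IH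
        convolution_def sweedler_def matrix_coefficient_def)
qed

lemma keys_diag_word: "Poly_Mapping.keys (diag_word A act ms a) \<subseteq> {ws. length ws = length ms}"
proof (induction ms arbitrary: a)
  case Nil
  then show ?case by simp
next
  case (Cons m ms)
  have "Poly_Mapping.keys (fmap (\<lambda>ws. act x m # ws) (diag_word A act ms y))
      \<subseteq> {ws. length ws = length (m # ms)}" for x y
    using keys_fmap[of "\<lambda>ws. act x m # ws" "diag_word A act ms y"] Cons.IH[of y] by fastforce
  then show ?case by (simp only: diag_word.simps, intro keys_fbind) (auto simp: case_prod_unfold)
qed

lemma convolution_add_left: "convolution A (\<lambda>a. f a + g a) h = (\<lambda>a. convolution A f h a + convolution A g h a)"
  by (simp add: convolution_def fun_eq_iff distrib_right sweedler_add)

lemma convolution_add_right: "convolution A f (\<lambda>a. g a + h a) = (\<lambda>a. convolution A f g a + convolution A f h a)"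
  by (simp add: convolution_def fun_eq_iff distrib_left sweedler_add)

lemma convolution_scale_left: "convolution A (\<lambda>a. r * f a) h = (\<lambda>a. r * convolution A f h a)"
  by (simp add: convolution_def fun_eq_iff mult.assoc sweedler_scale)

lemma convolution_scale_right: "convolution A f (\<lambda>a. r * h a) = (\<lambda>a. r * convolution A f h a)"
  by (simp add: convolution_def fun_eq_iff mult.left_commute sweedler_scale)

lemma coefficient_algebra_pairing:
  assumes "\<And>x. F x \<in> coefficient_algebra A sM act"
  shows "(\<lambda>a. pairing (\<lambda>x. F x a) t) \<in> coefficient_algebra A sM act"
proof -
  have "(\<lambda>a. \<Sum>x\<in>K. Poly_Mapping.lookup t x * F x a) \<in> coefficient_algebra A sM act" for K
  proof (induction K rule: infinite_finite_induct)
    case (insert x K)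
    then show ?case
      using coefficient_algebra.add[OF coefficient_algebra.scale[OF assms]] by simp
  next
    case empty
    show ?case using coefficient_algebra.scale[OF coefficient_algebra.unit, of 0] by simp
  next
    case (infinite K)
    then show ?case using coefficient_algebra.scale[OF coefficient_algebra.unit, of 0] by simp
  qed
  then show ?thesis by (simp add: lin_ext_def)
qed

locale finite_hopf_module = hopf_algebra A + M: left_module A sM act
  for A :: "('k::field, 'a::ring_1) hopf"
    and sM :: "'k \<Rightarrow> 'm::ab_group_add \<Rightarrow> 'm"
    and act :: "'a \<Rightarrow> 'm \<Rightarrow> 'm" +
  assumes finite_dim: "\<exists>Basis. finite_dimensional_vector_space (hscale A) Basis"
    and finite_dim_module: "\<exists>Basis. finite_dimensional_vector_space sM Basis"
begin

abbreviation lin :: "('a \<Rightarrow> 'k) \<Rightarrow> bool" where "lin \<equiv> linear_form (hscale A)"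
abbreviation linM :: "('m \<Rightarrow> 'k) \<Rightarrow> bool" where "linM \<equiv> linear_form sM"
abbreviation conv where "conv \<equiv> convolution A"
abbreviation coefficient :: "'m \<Rightarrow> ('m \<Rightarrow> 'k) \<Rightarrow> 'a \<Rightarrow> 'k" where
  "coefficient \<equiv> matrix_coefficient act"
abbreviation coefficients where "coefficients \<equiv> coefficient_algebra A sM act"
text \<open>The ideal \<open>I\<close>.\<close>

definition ann where "ann = (\<Inter>n. power_annihilator A sM act n)"

lemma coordinates_hspace: "\<exists>B \<beta>. coordinates (hspace A) B \<beta>"
  using adapted_basis[OF finite_dim subspace_UNIV] coordinates_full_space by metis

lemma coordinates_module: "\<exists>B \<beta>. coordinates (full_space sM) B \<beta>"
  using M.adapted_basis[OF finite_dim_module M.subspace_UNIV] M.coordinates_full_space by metis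

lemma linear_coefficient: "linM \<phi> \<Longrightarrow> lin (coefficient m \<phi>)"
  by (intro linear_formI vector_space_axioms)
    (simp_all add: matrix_coefficient_def M.act_add_left M.act_scale_left linear_add linear_scale)

lemma linear_form_act: "linM \<phi> \<Longrightarrow> linM (\<lambda>m. \<phi> (act a m))"
  by (intro linear_formI M.vector_space_axioms)
    (simp_all add: M.act_add_right M.act_scale_right linear_add linear_scale)

lemma lin_coefficients: "w \<in> coefficients \<Longrightarrow> lin w"
proof (induction rule: coefficient_algebra.induct)
  case unit
  show ?case by (rule linear_form_counit)
next
  case (step \<phi> g m)
  then show ?case by (intro linear_form_convolution linear_coefficient)
next
  case (add g h)
  then show ?case by (intro linear_formI vector_space_axioms) (simp_all add: linear_add linear_scale algebra_simps)
next
  case (scale g r)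
  show ?case using scale.IH by (rule linear_form_times')
qed

lemma coefficient_in_coefficients: "linM \<phi> \<Longrightarrow> coefficient m \<phi> \<in> coefficients"
  using coefficient_algebra.step[OF _ coefficient_algebra.unit, of sM \<phi> A act m]
  by (simp add: convolution_counit linear_coefficient)

lemma conv_coefficients:
  assumes w: "w \<in> coefficients" and w': "w' \<in> coefficients"
  shows "conv w w' \<in> coefficients"
  using w
proof (induction rule: coefficient_algebra.induct)
  case unit
  show ?case by (simp add: convolution_counit lin_coefficients w')
next
  case (step \<phi> g m)
  then show ?case
    by (simp add: convolution_assoc linear_coefficient lin_coefficients w' coefficient_algebra.step)
next
  case (add g h)
  then show ?case by (simp add: convolution_add_left coefficient_algebra.add)
next
  case (scale g r)
  then show ?case by (simp add: convolution_scale_left coefficient_algebra.scale)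
qed

text \<open>\<open>D\<close> is stable under translations of the argument. For a generator this is clear:
  \<open>\<phi>((a b) m) = \<phi>(a (b m))\<close> is a coefficient at the vector \<open>b m\<close>. On a product the translation by \<open>b\<close>
  is a finite sum of products of translations by \<open>b\<^sub>1\<close> and \<open>b\<^sub>2\<close>.\<close>

lemma coefficients_mult_right: "w \<in> coefficients \<Longrightarrow> (\<lambda>a. w (a * b)) \<in> coefficients"
proof (induction arbitrary: b rule: coefficient_algebra.induct)
  case unit
  show ?case using coefficient_algebra.scale[OF coefficient_algebra.unit, where r = "counit A b"]
    by (simp add: counit_mult mult.commute)
next
  case (step \<phi> g m)
  have "conv (coefficient m \<phi>) g (a * b)
      = pairing (\<lambda>p. conv (coefficient (act (fst p) m) \<phi>) (\<lambda>y. g (y * snd p)) a) (sw2 A b)" for a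
  proof -
    have "conv (coefficient m \<phi>) g (a * b)
        = sweedler A (\<lambda>x y. sweedler A (\<lambda>u v. coefficient m \<phi> (x * u) * g (y * v)) b) a"
      by (rule convolution_mult[OF linear_coefficient[OF step.hyps(1)] lin_coefficients[OF step.hyps(2)]])
    also have "\<dots> = sweedler A (\<lambda>u v. sweedler A (\<lambda>x y. coefficient (act u m) \<phi> x * g (y * v)) a) b"
      by (subst sweedler_swap) (simp add: matrix_coefficient_def M.act_mult)
    finally show ?thesis by (simp add: sweedler_def[of A _ b] convolution_def case_prod_unfold)
  qed
  moreover have "(\<lambda>a. pairing (\<lambda>p. conv (coefficient (act (fst p) m) \<phi>) (\<lambda>y. g (y * snd p)) a) (sw2 A b))
      \<in> coefficients"
    by (intro coefficient_algebra_pairing coefficient_algebra.step step)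
  ultimately show ?case by simp
next
  case (add g h)
  then show ?case by (simp add: coefficient_algebra.add)
next
  case (scale g r)
  then show ?case by (simp add: coefficient_algebra.scale)
qed

text \<open>The same for translations on the left, with \<open>\<phi>(b (a m))\<close> a coefficient at the form
  \<open>n \<mapsto> \<phi>(b n)\<close>.\<close>

lemma coefficients_mult_left: "w \<in> coefficients \<Longrightarrow> (\<lambda>a. w (b * a)) \<in> coefficients"
proof (induction arbitrary: b rule: coefficient_algebra.induct)
  case unit
  show ?case using coefficient_algebra.scale[OF coefficient_algebra.unit, where r = "counit A b"]
    by (simp add: counit_mult)
next
  case (step \<phi> g m)
  have "conv (coefficient m \<phi>) g (b * a)
      = pairing (\<lambda>p. conv (coefficient m (\<lambda>n. \<phi> (act (fst p) n))) (\<lambda>y. g (snd p * y)) a) (sw2 A b)" for a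
  proof -
    have "conv (coefficient m \<phi>) g (b * a)
        = sweedler A (\<lambda>x y. sweedler A (\<lambda>u v. coefficient m \<phi> (x * u) * g (y * v)) a) b"
      by (rule convolution_mult[OF linear_coefficient[OF step.hyps(1)] lin_coefficients[OF step.hyps(2)]])
    then show ?thesis
      by (simp add: sweedler_def[of A _ b] convolution_def case_prod_unfold matrix_coefficient_def M.act_mult)
  qed
  moreover have "(\<lambda>a. pairing (\<lambda>p. conv (coefficient m (\<lambda>n. \<phi> (act (fst p) n))) (\<lambda>y. g (snd p * y)) a) (sw2 A b))
      \<in> coefficients"
    by (intro coefficient_algebra_pairing coefficient_algebra.step linear_form_act step)
  ultimately show ?case by simp
next
  case (add g h)
  then show ?case by (simp add: coefficient_algebra.add)
next
  case (scale g r)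
  then show ?case by (simp add: coefficient_algebra.scale)
qed

lemma lin_word_coefficient:
  "\<forall>(m, \<phi>)\<in>set l. linM \<phi> \<Longrightarrow> lin (word_coefficient A act l)"
proof (induction l)
  case Nil
  show ?case by (simp add: linear_form_counit)
next
  case (Cons p l)
  then show ?case by (cases p) (simp add: linear_form_convolution linear_coefficient)
qed

lemma word_coefficient_in_coefficients:
  "\<forall>(m, \<phi>)\<in>set l. linM \<phi> \<Longrightarrow> word_coefficient A act l \<in> coefficients"
  by (induction l) (auto intro: coefficient_algebra.unit coefficient_algebra.step)

lemma word_coefficient_snoc:
  "\<forall>(m, \<phi>)\<in>set l. linM \<phi> \<Longrightarrow> linM \<phi> \<Longrightarrow>
    word_coefficient A act (l @ [(m, \<phi>)]) = conv (word_coefficient A act l) (coefficient m \<phi>)"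
  by (induction l)
    (auto simp: convolution_counit linear_coefficient convolution_assoc lin_word_coefficient)

text \<open>The products of generators span \<open>D\<close>. The induction needs the stronger statement that
  \<open>word * w\<close> vanishes at \<open>a\<close>, since a generator split off from \<open>w\<close> has to be moved into the word.\<close>

lemma coefficients_vanish:
  assumes a: "\<And>l. \<forall>(m, \<phi>)\<in>set l. linM \<phi> \<Longrightarrow> word_coefficient A act l a = 0"
    and w: "w \<in> coefficients"
  shows "w a = 0"
proof -
  have "conv (word_coefficient A act l) w a = 0" if "\<forall>(m, \<phi>)\<in>set l. linM \<phi>" for l
    using w that
  proof (induction arbitrary: l rule: coefficient_algebra.induct)
    case unit
    then show ?case by (simp add: convolution_counit lin_word_coefficient a)
  next
    case (step \<phi> g m)
    then have "conv (word_coefficient A act l) (conv (coefficient m \<phi>) g)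
        = conv (word_coefficient A act (l @ [(m, \<phi>)])) g"
      by (simp add: word_coefficient_snoc convolution_assoc lin_word_coefficient linear_coefficient
          lin_coefficients)
    then show ?case using step by auto
  next
    case (add g h)
    then show ?case by (simp add: convolution_add_right)
  next
    case (scale g r)
    then show ?case by (simp add: convolution_scale_right)
  qed
  from this[of "[]"] show ?thesis by (simp add: convolution_counit lin_coefficients w)
qed

lemma linear_word_coefficient_slot:
  assumes "\<forall>\<phi>\<in>set \<phi>s. linM \<phi>" "length \<phi>s = length xs + length ys + 1"
  shows "linM (\<lambda>v. word_coefficient A act (zip (xs @ v # ys) \<phi>s) a)"
  using assms
proof (induction xs arbitrary: \<phi>s a)
  case Nil
  then obtain \<phi> \<phi>s' where \<phi>s: "\<phi>s = \<phi> # \<phi>s'" "linM \<phi>" by (cases \<phi>s) auto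
  show ?case
    by (simp add: \<phi>s(1) convolution_def matrix_coefficient_def)
      (intro linear_form_sweedler_args M.vector_space_axioms M.linear_form_times linear_form_act \<phi>s(2))
next
  case (Cons x xs)
  then obtain \<phi> \<phi>s' where \<phi>s: "\<phi>s = \<phi> # \<phi>s'" by (cases \<phi>s) auto
  have IH: "linM (\<lambda>v. word_coefficient A act (zip (xs @ v # ys) \<phi>s') y)" for y
    using Cons.prems by (intro Cons.IH) (simp_all add: \<phi>s)
  show ?case
    by (simp add: \<phi>s convolution_def)
      (intro linear_form_sweedler_args M.vector_space_axioms M.linear_form_times' IH)
qed

text \<open>Both sides say that \<open>a\<close> acts as zero on \<open>M\<^sup>\<otimes>\<^sup>n\<close>, the right side through matrix coefficients.
  The arbitrary representative \<open>rep T\<close> in the action is harmless for two reasons: it is a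
  combination of words of length \<open>n\<close> like every representative, and word coefficients are linear in
  each letter, hence do not see the difference between representatives.\<close>

lemma power_annihilator_iff:
  "a \<in> power_annihilator A sM act n \<longleftrightarrow> (\<forall>ms \<phi>s. length ms = n \<longrightarrow> length \<phi>s = n \<longrightarrow>
     (\<forall>\<phi>\<in>set \<phi>s. linM \<phi>) \<longrightarrow> word_coefficient A act (zip ms \<phi>s) a = 0)"
    (is "_ \<longleftrightarrow> ?R")
proof -
  let ?V = "full_space sM"
  let ?N = "formal.span (rels_pow ?V n)"
  let ?D = "\<lambda>t. fbind t (\<lambda>ms. diag_word A act ms a)"
  have form: "form_on ?V \<phi> \<longleftrightarrow> linM \<phi>" for \<phi> by (rule form_on_full_space[OF M.vector_space_axioms])
  have rep: "rep (tens_pow ?V n t) - t \<in> ?N" for t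
  proof -
    have "t + 0 \<in> tens_pow ?V n t" unfolding tens_pow_def by (intro set_plus_intro2 formal.span_zero)
    then have "rep (tens_pow ?V n t) \<in> tens_pow ?V n t" unfolding rep_def by (rule someI)
    then show ?thesis by (simp add: tens_pow_def set_plus_imp_minus)
  qed
  have power: "tensor_power ?V n = tens_pow ?V n ` {t. Poly_Mapping.keys t \<subseteq> {ms. length ms = n}}"
    by (simp add: tensor_power_def)
  have "diag_act A sM act n a T = tens_pow ?V n 0 \<longleftrightarrow> ?D (rep T) \<in> ?N" for T
    unfolding diag_act_def tens_pow_def coset_eq_iff by simp
  then have ann: "a \<in> power_annihilator A sM act n \<longleftrightarrow>
      (\<forall>t. Poly_Mapping.keys t \<subseteq> {ms. length ms = n} \<longrightarrow> ?D (rep (tens_pow ?V n t)) \<in> ?N)"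
    unfolding power_annihilator_def power by blast
  have eval: "pairing (tensor_form \<phi>s) (?D t) = pairing (\<lambda>ms. word_coefficient A act (zip ms \<phi>s) a) t"
    if "length \<phi>s = n" "Poly_Mapping.keys t \<subseteq> {ms. length ms = n}" for t \<phi>s
    unfolding pairing_fbind using that by (intro lin_ext_cong pairing_diag_word) auto
  have keys: "Poly_Mapping.keys t \<subseteq> {ms. length ms = n}" if "t \<in> ?N" for t
  proof -
    have "rels_pow ?V n \<subseteq> {t. Poly_Mapping.keys t \<subseteq> {ms. length ms = n}}"
      unfolding rels_pow_def using keys_slot_rels[of _ _ _ "{ms. length ms = n}"] by fastforce
    then show ?thesis using formal.span_minimal[OF _ subspace_keys] that by blast
  qed
  have keys_rep: "Poly_Mapping.keys (rep (tens_pow ?V n t)) \<subseteq> {ms. length ms = n}"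
    if "Poly_Mapping.keys t \<subseteq> {ms. length ms = n}" for t
    using formal.subspace_add[OF subspace_keys, of "rep (tens_pow ?V n t) - t" _ t] keys[OF rep, of t] that
    by simp
  show ?thesis
  proof
    assume a: "a \<in> power_annihilator A sM act n"
    show ?R
    proof (intro allI impI)
      fix ms :: "'m list" and \<phi>s :: "('m \<Rightarrow> 'k) list"
      assume len: "length ms = n" "length \<phi>s = n" and \<phi>s: "\<forall>\<phi>\<in>set \<phi>s. linM \<phi>"
      let ?w = "\<lambda>ms. word_coefficient A act (zip ms \<phi>s) a" and ?t = "rep (tens_pow ?V n (pure ms))"
      have t: "Poly_Mapping.keys ?t \<subseteq> {ms. length ms = n}" by (rule keys_rep) (simp add: len)
      have "pairing ?w (?t - pure ms) = 0"
        using rep by (rule pairing_rels_pow[rotated])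
          (unfold form, rule linear_word_coefficient_slot[OF \<phi>s], simp add: len)
      then have "?w ms = pairing ?w ?t" by (simp add: pairing_diff)
      also have "\<dots> = pairing (tensor_form \<phi>s) (?D ?t)" using eval[OF len(2) t] by simp
      also have "\<dots> = 0"
      proof (rule pairing_rels_pow)
        show "form_on ?V (\<lambda>v. tensor_form \<phi>s (xs @ v # ys))" if "length xs + length ys + 1 = n" for xs ys
          using that len \<phi>s by (intro form_on_tensor_form) (simp_all add: form)
        show "?D ?t \<in> ?N" using a len by (simp add: ann del: diag_word.simps)
      qed
      finally show "?w ms = 0" .
    qed
  next
    assume R: ?R
    obtain B \<beta> where B: "coordinates ?V B \<beta>" using coordinates_module by blast
    show "a \<in> power_annihilator A sM act n"
      unfolding ann
    proof (intro allI impI)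
      fix t :: "'m list \<Rightarrow>\<^sub>0 'k" assume t: "Poly_Mapping.keys t \<subseteq> {ms. length ms = n}"
      let ?t = "rep (tens_pow ?V n t)"
      note kt = keys_rep[OF t]
      show "?D ?t \<in> ?N"
      proof (rule in_span_rels_pow[OF B])
        show "Poly_Mapping.keys (?D ?t) \<subseteq> {ws. ws \<in> lists (car ?V) \<and> length ws = n}"
          using kt keys_diag_word[of A act] by (intro keys_fbind) fastforce
        fix \<phi>s :: "('m \<Rightarrow> 'k) list" assume \<phi>s: "length \<phi>s = n" "\<forall>\<phi>\<in>set \<phi>s. form_on ?V \<phi>"
        have "pairing (tensor_form \<phi>s) (?D ?t) = pairing (\<lambda>_. 0) ?t"
          unfolding eval[OF \<phi>s(1) kt] using R \<phi>s kt by (intro lin_ext_cong) (auto simp: form)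
        then show "pairing (tensor_form \<phi>s) (?D ?t) = 0" by simp
      qed
    qed
  qed
qed

lemma ann_iff: "a \<in> ann \<longleftrightarrow> (\<forall>w\<in>coefficients. w a = 0)"
proof
  assume a: "a \<in> ann"
  have "word_coefficient A act l a = 0" if l: "\<forall>(m, \<phi>)\<in>set l. linM \<phi>" for l
  proof -
    have "a \<in> power_annihilator A sM act (length l)" using a by (simp add: ann_def)
    then have "word_coefficient A act (zip (map fst l) (map snd l)) a = 0"
      by (rule power_annihilator_iff[THEN iffD1, rule_format]) (use l in auto)
    then show ?thesis by (simp add: zip_map_fst_snd)
  qed
  then show "\<forall>w\<in>coefficients. w a = 0" using coefficients_vanish by blast
next
  assume zero: "\<forall>w\<in>coefficients. w a = 0"
  show "a \<in> ann"
    unfolding ann_def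
  proof (rule INT_I, unfold power_annihilator_iff, intro allI impI)
    fix ms :: "'m list" and \<phi>s :: "('m \<Rightarrow> 'k) list"
    assume "\<forall>\<phi>\<in>set \<phi>s. linM \<phi>"
    then have "\<forall>(m, \<phi>)\<in>set (zip ms \<phi>s). linM \<phi>" by (auto dest: set_zip_rightD)
    then show "word_coefficient A act (zip ms \<phi>s) a = 0"
      using zero word_coefficient_in_coefficients by blast
  qed
qed

section \<open>The annihilator is a Hopf ideal\<close>

lemma subspace_ann: "subspace ann"
proof (intro subspaceI)
  fix x y c
  show "0 \<in> ann" unfolding ann_iff using lin_coefficients linear_zero by blast
  show "x + y \<in> ann" if "x \<in> ann" "y \<in> ann"
    using that unfolding ann_iff by (metis add.right_neutral lin_coefficients linear_add)
  show "hscale A c x \<in> ann" if "x \<in> ann"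
    using that unfolding ann_iff by (metis lin_coefficients linear_scale mult_zero_right)
qed

text \<open>For \<open>f\<close> and \<open>g\<close> in \<open>D\<close> this is closure of \<open>D\<close> under products. It is extended to arbitrary
  forms that vanish on \<open>I\<close> in one argument at a time: for \<open>w\<close> in \<open>D\<close> the vector \<open>\<Sum> w(a\<^sub>1) a\<^sub>2\<close> lies in
  \<open>I\<close>, which settles \<open>w * g\<close>; then \<open>\<Sum> a\<^sub>1 g(a\<^sub>2)\<close> lies in \<open>I\<close>.\<close>

lemma conv_ann:
  assumes f: "lin f" "\<forall>x\<in>ann. f x = 0" and g: "lin g" "\<forall>x\<in>ann. g x = 0" and a: "a \<in> ann"
  shows "conv f g a = 0"
proof -
  have "conv w g a = 0" if w: "w \<in> coefficients" for w
  proof -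
    have "hit_left A w a \<in> ann"
      unfolding ann_iff using a conv_coefficients[OF w]
      by (auto simp: linear_form_hit_left lin_coefficients ann_iff)
    then show ?thesis using g(2) linear_form_hit_left[OF g(1), of w a] by simp
  qed
  then have "hit_right A g a \<in> ann"
    unfolding ann_iff by (simp add: linear_form_hit_right lin_coefficients)
  then show ?thesis using f(2) linear_form_hit_right[OF f(1), of g a] by simp
qed

lemma hopf_ideal_ann: "hopf_ideal A ann"
proof -
  have zero: "w a = 0" if "w \<in> coefficients" "a \<in> ann" for w a
    using that by (simp add: ann_iff)
  have left: "b * a \<in> ann" and right: "a * b \<in> ann" if "a \<in> ann" for a b
    using zero[OF coefficients_mult_left that] zero[OF coefficients_mult_right that]
    by (simp_all add: ann_iff)
  have counit: "counit A a = 0" if "a \<in> ann" for a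
    by (rule zero[OF coefficient_algebra.unit that])
  have comul: "comul A a \<in>
      tensor_image (hspace A) (hspace A) ann UNIV + tensor_image (hspace A) (hspace A) UNIV ann"
    if "a \<in> ann" for a
    unfolding comul_tensor
    by (rule in_tensor_image_sum[OF finite_dim subspace_ann subspace_ann])
      (use conv_ann[OF _ _ _ _ that] in \<open>simp add: convolution_def sweedler_def\<close>)
  show ?thesis
    unfolding hopf_ideal_def
    by (intro conjI allI ballI subspace_ann left right counit comul
        antipode_stable[OF finite_dim subspace_ann left right comul counit])
qed

section \<open>Coinvariants\<close>

text \<open>The hypothesis places \<open>z - r 1\<close> in \<open>I\<close>. This is how an identity that is known for the forms in
  \<open>D\<close> passes to all forms on \<open>A / I\<close>.\<close>

lemma linear_form_vanishing_on_ann: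
  assumes g: "lin g" "\<forall>x\<in>ann. g x = 0"
    and z: "\<And>w. w \<in> coefficients \<Longrightarrow> w z = r * w 1"
  shows "g z = r * g 1"
proof -
  have "z - hscale A r 1 \<in> ann"
    unfolding ann_iff by (auto simp: z linear_diff[OF lin_coefficients] linear_scale[OF lin_coefficients])
  then have "g (z - hscale A r 1) = 0" using g by blast
  then show ?thesis by (simp add: linear_diff[OF g(1)] linear_scale[OF g(1)])
qed

abbreviation quot where "quot \<equiv> quotient_space (hscale A) ann"
abbreviation proj where "proj \<equiv> \<lambda>a. a +o ann"

lemma proj_in_quot [simp]: "proj a \<in> car quot"
  by (simp add: quotient_space_def)

lemma form_hspace: "form_on (hspace A) f \<longleftrightarrow> lin f"
  by (rule form_on_full_space[OF vector_space_axioms])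

lemma all_forms_on_quot:
  "(\<forall>g. form_on quot g \<longrightarrow> P (\<lambda>a. g (proj a))) \<longleftrightarrow> (\<forall>g. lin g \<longrightarrow> (\<forall>x\<in>ann. g x = 0) \<longrightarrow> P g)"
proof (intro iffI allI impI)
  fix g assume "\<forall>g. form_on quot g \<longrightarrow> P (\<lambda>a. g (proj a))" "lin g" "\<forall>x\<in>ann. g x = 0"
  then show "P g"
    using form_on_coset_form[OF subspace_ann, of g] coset_form_coset[OF subspace_ann, of g]
    by (auto dest: spec[of _ "coset_form g"])
next
  fix g assume "\<forall>g. lin g \<longrightarrow> (\<forall>x\<in>ann. g x = 0) \<longrightarrow> P g" "form_on quot g"
  then show "P (\<lambda>a. g (proj a))"
    using form_on_quotient_space[OF subspace_ann, of g] by blast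
qed

lemma right_coinvariants_iff:
  "a \<in> right_coinvariants A quot proj \<longleftrightarrow>
    (\<forall>f g. lin f \<longrightarrow> lin g \<longrightarrow> (\<forall>x\<in>ann. g x = 0) \<longrightarrow> conv f g a = f a * g 1)"
proof -
  obtain B \<beta> C \<gamma> where "coordinates (hspace A) B \<beta>" "coordinates quot C \<gamma>"
    using coordinates_hspace coordinates_quotient_space[OF finite_dim subspace_ann] by blast
  note iff = tens2_eq_iff[OF this]
  have "a \<in> right_coinvariants A quot proj \<longleftrightarrow> (\<forall>g. form_on quot g \<longrightarrow> (\<forall>f. lin f \<longrightarrow>
      conv f (\<lambda>a. g (proj a)) a = f a * g (proj 1)))"
    unfolding right_coinvariants_def mem_Collect_eq
    using keys_fmap[of "\<lambda>(x, y). (x, proj y)" "sw2 A a"]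
    by (subst iff)
      (auto simp: form_hspace pairing_fmap case_prod_unfold convolution_def sweedler_def)
  then show ?thesis
    using all_forms_on_quot[of "\<lambda>g. \<forall>f. lin f \<longrightarrow> conv f g a = f a * g 1"] by auto
qed


lemma left_coinvariants_iff:
  "a \<in> left_coinvariants A quot proj \<longleftrightarrow>
    (\<forall>f g. lin f \<longrightarrow> lin g \<longrightarrow> (\<forall>x\<in>ann. g x = 0) \<longrightarrow> conv g f a = g 1 * f a)"
proof -
  obtain B \<beta> C \<gamma> where "coordinates quot C \<gamma>" "coordinates (hspace A) B \<beta>"
    using coordinates_hspace coordinates_quotient_space[OF finite_dim subspace_ann] by blast
  note iff = tens2_eq_iff[OF this]
  have "a \<in> left_coinvariants A quot proj \<longleftrightarrow> (\<forall>g. form_on quot g \<longrightarrow> (\<forall>f. lin f \<longrightarrow>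
      conv (\<lambda>a. g (proj a)) f a = g (proj 1) * f a))"
    unfolding left_coinvariants_def mem_Collect_eq
    using keys_fmap[of "\<lambda>(x, y). (proj x, y)" "sw2 A a"]
    by (subst iff)
      (auto simp: form_hspace pairing_fmap case_prod_unfold convolution_def sweedler_def)
  then show ?thesis
    using all_forms_on_quot[of "\<lambda>g. \<forall>f. lin f \<longrightarrow> conv g f a = g 1 * f a"] by auto
qed

lemma form_module: "form_on (full_space sM) \<phi> \<longleftrightarrow> linM \<phi>"
  by (rule form_on_full_space[OF M.vector_space_axioms])

lemma LKer_iff:
  "a \<in> LKer A sM act \<longleftrightarrow>
    (\<forall>f m \<phi>. lin f \<longrightarrow> linM \<phi> \<longrightarrow> conv f (coefficient m \<phi>) a = f a * \<phi> m)"
proof -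
  obtain B \<beta> C \<gamma> where "coordinates (hspace A) B \<beta>" "coordinates (full_space sM) C \<gamma>"
    using coordinates_hspace coordinates_module by blast
  note iff = tens2_eq_iff[OF this]
  show ?thesis
    unfolding LKer_def mem_Collect_eq
    by (subst iff)
      (auto simp: form_hspace form_module pairing_fmap case_prod_unfold convolution_def
        sweedler_def matrix_coefficient_def)
qed

lemma RKer_iff:
  "a \<in> RKer A sM act \<longleftrightarrow>
    (\<forall>f m \<phi>. lin f \<longrightarrow> linM \<phi> \<longrightarrow> conv (coefficient m \<phi>) f a = \<phi> m * f a)"
proof -
  obtain B \<beta> C \<gamma> where "coordinates (hspace A) B \<beta>" "coordinates (full_space sM) C \<gamma>"
    using coordinates_hspace coordinates_module by blast
  note iff = tens2_eq_iff[OF this]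
  show ?thesis
    unfolding RKer_def mem_Collect_eq
    by (subst iff)
      (auto simp: form_hspace form_module pairing_fmap case_prod_unfold convolution_def
        sweedler_def matrix_coefficient_def mult.commute)
qed

lemma coefficient_vanishes_on_ann: "linM \<phi> \<Longrightarrow> x \<in> ann \<Longrightarrow> coefficient m \<phi> x = 0"
  using coefficient_in_coefficients ann_iff by simp

lemma coefficient_one [simp]: "coefficient m \<phi> 1 = \<phi> m"
  by (simp add: matrix_coefficient_def M.act_one)

lemma coefficients_one:
  "linM \<phi> \<Longrightarrow> g \<in> coefficients \<Longrightarrow> conv (coefficient m \<phi>) g 1 = \<phi> m * g 1"
  by (simp add: convolution_one linear_coefficient lin_coefficients)

text \<open>A matrix coefficient vanishes on \<open>I\<close>, which gives one inclusion. For the other, the identity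
  \<open>(f * w)(a) = f(a) w(1)\<close> extends from generators to \<open>D\<close> because
  \<open>f * (c * g) = (f * c) * g\<close>: apply the identity for \<open>g\<close> with the form
  \<open>f * c\<close>, and then the one for \<open>c\<close>.\<close>

lemma right_coinvariants_eq_LKer: "right_coinvariants A quot proj = LKer A sM act"
proof (intro set_eqI iffI)
  fix a assume "a \<in> right_coinvariants A quot proj"
  then show "a \<in> LKer A sM act"
    by (simp add: right_coinvariants_iff LKer_iff linear_coefficient coefficient_vanishes_on_ann)
next
  fix a assume "a \<in> LKer A sM act"
  then have a: "conv f (coefficient m \<phi>) a = f a * \<phi> m" if "lin f" "linM \<phi>" for f m \<phi>
    using that by (simp add: LKer_iff)
  have W: "conv f w a = f a * w 1" if "w \<in> coefficients" "lin f" for f w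
    using that
  proof (induction arbitrary: f rule: coefficient_algebra.induct)
    case unit
    then show ?case by (simp add: convolution_counit counit_one)
  next
    case (step \<phi> g m)
    have "conv f (conv (coefficient m \<phi>) g) a = conv (conv f (coefficient m \<phi>)) g a"
      using step by (simp add: convolution_assoc linear_coefficient lin_coefficients)
    also have "\<dots> = f a * \<phi> m * g 1"
      using step by (simp add: linear_form_convolution linear_coefficient a)
    finally show ?case using step by (simp add: coefficients_one)
  next
    case (add g h)
    then show ?case by (simp add: convolution_add_right distrib_left)
  next
    case (scale g r)
    then show ?case by (simp add: convolution_scale_right)
  qed
  show "a \<in> right_coinvariants A quot proj"
    unfolding right_coinvariants_iff
  proof (intro allI impI)
    fix f g assume f: "lin f" and g: "lin g" "\<forall>x\<in>ann. g x = 0"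
    have "g (hit_left A f a) = f a * g 1"
      by (rule linear_form_vanishing_on_ann[OF g]) (simp add: linear_form_hit_left lin_coefficients W f)
    then show "conv f g a = f a * g 1" by (simp add: linear_form_hit_left g(1))
  qed
qed

lemma left_coinvariants_eq_RKer: "left_coinvariants A quot proj = RKer A sM act"
proof (intro set_eqI iffI)
  fix a assume "a \<in> left_coinvariants A quot proj"
  then show "a \<in> RKer A sM act"
    by (simp add: left_coinvariants_iff RKer_iff linear_coefficient coefficient_vanishes_on_ann)
next
  fix a assume "a \<in> RKer A sM act"
  then have a: "conv (coefficient m \<phi>) f a = \<phi> m * f a" if "lin f" "linM \<phi>" for f m \<phi>
    using that by (simp add: RKer_iff)
  have W: "conv w f a = f a * w 1" if "w \<in> coefficients" "lin f" for f w
    using that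
  proof (induction arbitrary: f rule: coefficient_algebra.induct)
    case unit
    then show ?case by (simp add: convolution_counit counit_one)
  next
    case (step \<phi> g m)
    then show ?case
      by (simp add: convolution_assoc linear_coefficient lin_coefficients linear_form_convolution a
          coefficients_one)
  next
    case (add g h)
    then show ?case by (simp add: convolution_add_left distrib_left)
  next
    case (scale g r)
    then show ?case by (simp add: convolution_scale_left)
  qed
  show "a \<in> left_coinvariants A quot proj"
    unfolding left_coinvariants_iff
  proof (intro allI impI)
    fix f g assume f: "lin f" and g: "lin g" "\<forall>x\<in>ann. g x = 0"
    have "g (hit_right A f a) = f a * g 1"
      by (rule linear_form_vanishing_on_ann[OF g]) (simp add: linear_form_hit_right lin_coefficients W f)
    then show "conv g f a = g 1 * f a" by (simp add: linear_form_hit_right g(1))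
  qed
qed

section \<open>The Hopf kernel\<close>

lemma HKer_iff_forms:
  "a \<in> HKer A quot proj \<longleftrightarrow> (\<forall>f g h. lin f \<longrightarrow> lin g \<longrightarrow> lin h \<longrightarrow> (\<forall>x\<in>ann. g x = 0) \<longrightarrow>
    conv f (conv g h) a = g 1 * conv f h a)"
proof -
  obtain B \<beta> C \<gamma> where BC: "coordinates (hspace A) B \<beta>" "coordinates quot C \<gamma>"
    using coordinates_hspace coordinates_quotient_space[OF finite_dim subspace_ann] by blast
  note iff = tens3_eq_iff[OF BC BC(1)]
  have middle: "pairing (\<lambda>p. f (fst p) * (r * h (snd p))) t = r * pairing (\<lambda>p. f (fst p) * h (snd p)) t"
    for f h :: "'a \<Rightarrow> 'k" and r t
    by (simp add: mult.left_commute[of _ r] pairing_scale_fun)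
  have "a \<in> HKer A quot proj \<longleftrightarrow> (\<forall>g. form_on quot g \<longrightarrow> (\<forall>f h. lin f \<longrightarrow> lin h \<longrightarrow>
      conv f (conv (\<lambda>a. g (proj a)) h) a = g (proj 1) * conv f h a))"
    unfolding HKer_def mem_Collect_eq
    using keys_fmap[of "\<lambda>(x, y, z). (x, proj y, z)" "sw3 A a"]
      keys_fmap[of "\<lambda>(x, z). (x, proj 1, z)" "sw2 A a"]
    by (subst iff)
      (auto simp: form_hspace sw3_def pairing_fbind pairing_fmap case_prod_unfold convolution_def
        sweedler_def middle pairing_scale_fun)
  then show ?thesis
    unfolding all_forms_on_quot[of "\<lambda>g. \<forall>f h. lin f \<longrightarrow> lin h \<longrightarrow> conv f (conv g h) a = g 1 * conv f h a"]
    by blast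
qed

text \<open>As for the coinvariants, the identity extends from matrix coefficients to \<open>D\<close>, and then to all
  forms on \<open>A / I\<close> by means of the vector \<open>\<Sum> f(a\<^sub>1) a\<^sub>2 h(a\<^sub>3)\<close>.\<close>

lemma HKer_iff:
  "a \<in> HKer A quot proj \<longleftrightarrow> (\<forall>f h m \<phi>. lin f \<longrightarrow> lin h \<longrightarrow> linM \<phi> \<longrightarrow>
    conv f (conv (coefficient m \<phi>) h) a = \<phi> m * conv f h a)"
proof
  assume "a \<in> HKer A quot proj"
  then show "\<forall>f h m \<phi>. lin f \<longrightarrow> lin h \<longrightarrow> linM \<phi> \<longrightarrow>
      conv f (conv (coefficient m \<phi>) h) a = \<phi> m * conv f h a"
    by (simp add: HKer_iff_forms linear_coefficient coefficient_vanishes_on_ann)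
next
  assume a: "\<forall>f h m \<phi>. lin f \<longrightarrow> lin h \<longrightarrow> linM \<phi> \<longrightarrow>
      conv f (conv (coefficient m \<phi>) h) a = \<phi> m * conv f h a"
  have W: "conv f (conv w h) a = conv f h a * w 1" if "w \<in> coefficients" "lin f" "lin h" for f h w
    using that
  proof (induction arbitrary: h rule: coefficient_algebra.induct)
    case unit
    then show ?case by (simp add: convolution_counit counit_one)
  next
    case (step \<phi> g m)
    then show ?case
      by (simp add: convolution_assoc linear_coefficient lin_coefficients linear_form_convolution a
          coefficients_one)
  next
    case (add g h)
    then show ?case by (simp add: convolution_add_left convolution_add_right distrib_left)
  next
    case (scale g r)
    then show ?case by (simp add: convolution_scale_left convolution_scale_right)
  qed
  show "a \<in> HKer A quot proj"
    unfolding HKer_iff_forms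
  proof (intro allI impI)
    fix f g h assume f: "lin f" and g: "lin g" "\<forall>x\<in>ann. g x = 0" and h: "lin h"
    have "g (hit_right A h (hit_left A f a)) = conv f h a * g 1"
      by (rule linear_form_vanishing_on_ann[OF g])
        (simp add: linear_form_hit_left linear_form_hit_right linear_form_convolution lin_coefficients W f h)
    then show "conv f (conv g h) a = g 1 * conv f h a"
      by (simp add: linear_form_hit_left linear_form_hit_right linear_form_convolution g(1) h)
  qed
qed

abbreviation ker where "ker \<equiv> HKer A quot proj"

lemma kerD: "a \<in> ker \<Longrightarrow> lin f \<Longrightarrow> lin h \<Longrightarrow> linM \<phi> \<Longrightarrow>
    conv f (conv (coefficient m \<phi>) h) a = \<phi> m * conv f h a"
  by (simp add: HKer_iff)

lemma subspace_ker: "subspace ker"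
proof (intro subspaceI)
  have lin: "lin (conv f (conv (coefficient m \<phi>) h))" "lin (conv f h)"
    if "lin f" "lin h" "linM \<phi>" for f h m \<phi>
    using that by (simp_all add: linear_form_convolution linear_coefficient)
  show "0 \<in> ker" by (simp add: HKer_iff linear_zero[OF lin(1)] linear_zero[OF lin(2)])
  show "x + y \<in> ker" if "x \<in> ker" "y \<in> ker" for x y
    using that by (simp add: HKer_iff linear_add[OF lin(1)] linear_add[OF lin(2)] distrib_left)
  show "hscale A c x \<in> ker" if "x \<in> ker" for c x
    using that by (simp add: HKer_iff linear_scale[OF lin(1)] linear_scale[OF lin(2)] mult.left_commute)
qed

lemma one_in_ker: "1 \<in> ker"
  by (simp add: HKer_iff convolution_one linear_form_convolution linear_coefficient)

text \<open>Expanding the coproduct of \<open>a b\<close>, the value at \<open>a b\<close> is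
  \<open>\<Sum> f(a\<^sub>1 b\<^sub>1) \<phi>(a\<^sub>2 b\<^sub>2 m) h(a\<^sub>3 b\<^sub>3)\<close>. For fixed \<open>b\<^sub>i\<close> the hypothesis on \<open>a\<close>, applied to the vector
  \<open>b\<^sub>2 m\<close>, removes \<open>a\<^sub>2\<close>; this leaves \<open>\<Sum> f(a\<^sub>1 b\<^sub>1) \<phi>(b\<^sub>2 m) h(a\<^sub>2 b\<^sub>3)\<close>, from which the hypothesis on
  \<open>b\<close> removes \<open>b\<^sub>2\<close>.\<close>

lemma mult_in_ker:
  assumes a: "a \<in> ker" and b: "b \<in> ker"
  shows "a * b \<in> ker"
  unfolding HKer_iff
proof (intro allI impI)
  fix f h m \<phi> assume f: "lin f" and h: "lin h" and \<phi>: "linM \<phi>"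
  let ?c = "coefficient m \<phi>" and ?sw = "sweedler A"
  note c = linear_coefficient[OF \<phi>, of m] and fm = linear_form_mult[OF f] and hm = linear_form_mult[OF h]
  \<comment> \<open>The removal of \<open>a\<^sub>2\<close>; \<open>x'\<close> stands for \<open>b\<^sub>1\<close>, and \<open>u'\<close>, \<open>v'\<close> for \<open>b\<^sub>2\<close>, \<open>b\<^sub>3\<close>.\<close>
  have inner: "?sw (\<lambda>x y. f (x * x') * conv ?c h (y * y')) a
      = ?sw (\<lambda>x v. f (x * x') * conv ?c (\<lambda>z. h (v * z)) y') a" for x' y'
  proof -
    have "?sw (\<lambda>x y. f (x * x') * conv ?c h (y * y')) a
        = ?sw (\<lambda>x y. ?sw (\<lambda>u' v'. f (x * x') * conv (coefficient (act u' m) \<phi>) (\<lambda>z. h (z * v')) y) y') a"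
      unfolding convolution_mult[OF c h] 
      by (subst sweedler_swap) (simp add: sweedler_scale convolution_def matrix_coefficient_def M.act_mult)
    also have "\<dots> = ?sw (\<lambda>u' v'. conv (\<lambda>z. f (z * x')) (conv (coefficient (act u' m) \<phi>) (\<lambda>z. h (z * v'))) a) y'"
      by (subst sweedler_swap) (simp add: convolution_def[of A "\<lambda>z. f (z * x')"])
    also have "\<dots> = ?sw (\<lambda>u' v'. \<phi> (act u' m) * ?sw (\<lambda>x v. f (x * x') * h (v * v')) a) y'"
      by (simp add: kerD[OF a fm(1) hm(1) \<phi>]) (simp add: convolution_def)
    also have "\<dots> = ?sw (\<lambda>u' v'. ?sw (\<lambda>x v. f (x * x') * (?c u' * h (v * v'))) a) y'"
      by (simp add: matrix_coefficient_def mult.left_commute flip: sweedler_scale)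
    also have "\<dots> = ?sw (\<lambda>x v. ?sw (\<lambda>u' v'. f (x * x') * (?c u' * h (v * v'))) y') a"
      by (rule sweedler_swap)
    finally show ?thesis by (simp add: sweedler_scale convolution_def)
  qed
  have "conv f (conv ?c h) (a * b) = ?sw (\<lambda>x y. ?sw (\<lambda>x' y'. f (x * x') * conv ?c h (y * y')) b) a"
    by (rule convolution_mult[OF f linear_form_convolution[OF c h]])
  also have "\<dots> = ?sw (\<lambda>x' y'. ?sw (\<lambda>x y. f (x * x') * conv ?c h (y * y')) a) b"
    by (rule sweedler_swap)
  also have "\<dots> = ?sw (\<lambda>x' y'. ?sw (\<lambda>x v. f (x * x') * conv ?c (\<lambda>z. h (v * z)) y') a) b"
    by (simp only: inner)
  also have "\<dots> = ?sw (\<lambda>x v. conv (\<lambda>z. f (x * z)) (conv ?c (\<lambda>z. h (v * z))) b) a"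
    by (subst sweedler_swap) (simp add: convolution_def[of A "\<lambda>z. f (_ * z)"])
  also have "\<dots> = ?sw (\<lambda>x v. \<phi> m * conv (\<lambda>z. f (x * z)) (\<lambda>z. h (v * z)) b) a"
    by (simp only: kerD[OF b fm(2) hm(2) \<phi>])
  also have "\<dots> = \<phi> m * conv f h (a * b)"
    by (simp add: sweedler_scale convolution_mult[OF f h]) (simp add: convolution_def)
  finally show "conv f (conv ?c h) (a * b) = \<phi> m * conv f h (a * b)" .
qed

lemma hit_in_ker:
  assumes a: "a \<in> ker" and g: "lin g"
  shows "hit_left A g a \<in> ker" "hit_right A g a \<in> ker"
proof -
  have "conv g (conv f (conv (coefficient m \<phi>) h)) a = \<phi> m * conv g (conv f h) a"
    if "lin f" "lin h" "linM \<phi>" for f h m \<phi>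
    using kerD[OF a linear_form_convolution[OF g that(1)] that(2,3)] that g
    by (simp add: convolution_assoc linear_form_convolution linear_coefficient)
  then show "hit_left A g a \<in> ker"
    by (simp add: HKer_iff linear_form_hit_left linear_form_convolution linear_coefficient)
  have "conv (conv f (conv (coefficient m \<phi>) h)) g a = \<phi> m * conv (conv f h) g a"
    if "lin f" "lin h" "linM \<phi>" for f h m \<phi>
    using kerD[OF a that(1) linear_form_convolution[OF that(2) g] that(3)] that g
    by (simp add: convolution_assoc linear_form_convolution linear_coefficient)
  then show "hit_right A g a \<in> ker"
    by (simp add: HKer_iff linear_form_hit_right linear_form_convolution linear_coefficient)
qed

lemma sub_bialgebra_ker: "sub_bialgebra A ker"
  unfolding sub_bialgebra_def
proof (intro conjI ballI)
  show "subspace ker" "1 \<in> ker" by (fact subspace_ker one_in_ker)+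
  show "x * y \<in> ker" if "x \<in> ker" "y \<in> ker" for x y using that by (rule mult_in_ker)
  fix a assume a: "a \<in> ker"
  show "comul A a \<in> tensor_image (hspace A) (hspace A) ker ker"
    unfolding comul_tensor
  proof (rule in_tensor_image[OF finite_dim subspace_ker subspace_ker])
    fix f g assume f: "lin f" and g: "lin g"
    have conv: "pairing (\<lambda>(x, y). f x * g y) (sw2 A a) = conv f g a"
      by (simp add: convolution_def sweedler_def)
    show "pairing (\<lambda>(x, y). f x * g y) (sw2 A a) = 0" if "\<forall>x\<in>ker. f x = 0"
      using that hit_in_ker(2)[OF a g] linear_form_hit_right[OF f, of g a] by (simp add: conv)
    show "pairing (\<lambda>(x, y). f x * g y) (sw2 A a) = 0" if "\<forall>x\<in>ker. g x = 0"
      using that hit_in_ker(1)[OF a f] linear_form_hit_left[OF g, of f a] by (simp add: conv)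
  qed
qed

lemma ker_trivial: "ker \<subseteq> trivial_part A sM act"
proof
  fix a assume a: "a \<in> ker"
  show "a \<in> trivial_part A sM act"
    unfolding trivial_part_def
  proof (intro CollectI allI M.linear_forms_separate[OF finite_dim_module])
    fix m \<phi> assume \<phi>: "linM \<phi>"
    have "conv (counit A) (conv (coefficient m \<phi>) (counit A)) a = \<phi> m * conv (counit A) (counit A) a"
      by (rule kerD[OF a linear_form_counit linear_form_counit \<phi>])
    then show "\<phi> (act a m) = \<phi> (sM (counit A a) m)"
      by (simp add: convolution_counit linear_coefficient linear_form_counit \<phi>)
        (simp add: matrix_coefficient_def linear_scale[OF \<phi>] mult.commute)
  qed
qed

lemma sweedler_cong_on:
  assumes "bilinear_form (hscale A) h" "bilinear_form (hscale A) h'"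
    and "comul A a \<in> tensor_image (hspace A) (hspace A) X Y"
    and "\<And>x y. x \<in> X \<Longrightarrow> y \<in> Y \<Longrightarrow> h x y = h' x y"
  shows "sweedler A h a = sweedler A h' a"
proof -
  obtain t where t: "comul A a = tensor (hscale A) t" "Poly_Mapping.keys t \<subseteq> X \<times> Y"
    using assms(3) by (auto simp: tensor_image_def)
  have "pairing (\<lambda>(x, y). h x y) t = pairing (\<lambda>(x, y). h' x y) t"
    using t(2) by (intro lin_ext_cong) (auto simp: assms(4))
  then show ?thesis using sweedler_representative[OF _ t(1)] assms(1,2) by simp
qed

text \<open>On \<open>H\<close> the coefficient \<open>c\<close> agrees with \<open>c(1) \<epsilon>\<close>. Since the coproduct of \<open>H\<close> can be represented by
  tensors with entries in \<open>H\<close>, this gives \<open>c * h = c(1) h\<close> on \<open>H\<close>, and then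
  \<open>f * (c * h) = c(1) f * h\<close> on \<open>H\<close>.\<close>

lemma sub_bialgebra_le_ker:
  assumes H: "sub_bialgebra A H" "H \<subseteq> trivial_part A sM act"
  shows "H \<subseteq> ker"
proof
  fix a assume a: "a \<in> H"
  have comul: "comul A x \<in> tensor_image (hspace A) (hspace A) H H" if "x \<in> H" for x
    using H(1) that by (simp add: sub_bialgebra_def)
  show "a \<in> ker"
    unfolding HKer_iff
  proof (intro allI impI)
    fix f h m \<phi> assume f: "lin f" and h: "lin h" and \<phi>: "linM \<phi>"
    note c = linear_coefficient[OF \<phi>, of m]
    have inner: "conv (coefficient m \<phi>) h y = \<phi> m * h y" if "y \<in> H" for y
    proof -
      have "conv (coefficient m \<phi>) h y = sweedler A (\<lambda>u v. (\<phi> m * counit A u) * h v) y"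
        unfolding convolution_def
      proof (rule sweedler_cong_on[OF _ _ comul[OF that]])
        fix u v assume "u \<in> H"
        then have "coefficient m \<phi> u = \<phi> m * counit A u"
          using H(2) by (auto simp: matrix_coefficient_def trivial_part_def linear_scale[OF \<phi>])
        then show "coefficient m \<phi> u * h v = \<phi> m * counit A u * h v" by simp
      qed (fact bilinear_form_times[OF c h]
          bilinear_form_times[OF linear_form_times'[OF linear_form_counit] h])+
      then show ?thesis
        by (simp add: sweedler_counit_left h mult.assoc sweedler_scale)
    qed
    have "conv f (conv (coefficient m \<phi>) h) a = sweedler A (\<lambda>x y. f x * (\<phi> m * h y)) a"
      unfolding convolution_def[of A f]
      by (rule sweedler_cong_on[OF _ _ comul[OF a]])
        (auto simp: inner intro!: bilinear_form_times f linear_form_times' h linear_form_convolution c)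
    then show "conv f (conv (coefficient m \<phi>) h) a = \<phi> m * conv f h a"
      by (simp add: convolution_def mult.left_commute sweedler_scale)
  qed
qed

lemma is_hopf_kernel_ker: "is_hopf_kernel A sM act ker"
  using sub_bialgebra_ker ker_trivial sub_bialgebra_le_ker by (simp add: is_hopf_kernel_def)

lemma hopf_kernel_eq_ker: "hopf_kernel A sM act = ker"
  unfolding hopf_kernel_def
  by (rule the_equality) (use is_hopf_kernel_ker in \<open>auto simp: is_hopf_kernel_def\<close>)

end

theorem theorem2p3p6:
  fixes A :: "('k::field, 'a::ring_1) hopf"
    and sM :: "'k \<Rightarrow> 'm::ab_group_add \<Rightarrow> 'm"
    and act :: "'a \<Rightarrow> 'm \<Rightarrow> 'm"
    and I :: "'a set"
    and B :: "('k, 'a set) vspace"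
    and \<pi> :: "'a \<Rightarrow> 'a set"
  assumes "hopf_algebra A"
    and "\<exists>Basis. finite_dimensional_vector_space (hscale A) Basis"
    and "left_module A sM act"
    and "\<exists>Basis. finite_dimensional_vector_space sM Basis"
    and "I = (\<Inter>n. power_annihilator A sM act n)"
    and "B = quotient_space (hscale A) I"
    and "\<pi> = (\<lambda>a. a +o I)"
  shows "hopf_ideal A I \<and>
    right_coinvariants A B \<pi> = LKer A sM act \<and>
    left_coinvariants A B \<pi> = RKer A sM act \<and>
    is_hopf_kernel A sM act (hopf_kernel A sM act) \<and>
    HKer A B \<pi> = hopf_kernel A sM act"
proof -
  interpret finite_hopf_module A sM act
    using assms(1-4) by (intro finite_hopf_module.intro finite_hopf_module_axioms.intro)
  have "I = ann" using assms(5) by (simp add: ann_def)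
  then show ?thesis
    using hopf_ideal_ann right_coinvariants_eq_LKer left_coinvariants_eq_RKer is_hopf_kernel_ker
    by (simp add: assms(6,7) hopf_kernel_eq_ker)
qed

end
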